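(* Let $h\in\overline{\mathrm{Conv}}(Z)$ for a nonempty convex set $Z\subseteq\mathcal Z$, $f\in\mathcal C_{m,M}(Z)$ with $m,M>0$, $\mathcal A:\mathcal Z\to\mathcal R$ a nonzero linear operator, $S\subseteq\mathcal R$ a closed convex set with $\mathcal F:=\{z\in\mathcal Z:\mathcal Az\in S\}\ne\emptyset$. For $c\ge0$ let $f_c(z)=f(z)+\frac c2\operatorname{dist}^2(\mathcal Az,S)$, $\varphi_c=f_c+h$ and $\hat\varphi_c=\inf_{z\in\mathcal Z}\varphi_c(z)$, and let $\hat c>0$ be such that $\hat\varphi_{\hat c}>-\infty$. Let $\hat\rho,\hat\eta>0$, $\sigma\in(0,1)$, $\lambda\in(0,1/m)$, $z_0\in Z$, and define $$T_{\hat\eta}(\lambda)=\hat c+\frac{2R^{\mathcal F}_\lambda\varphi_{\hat c}(z_0)}{\lambda(1-\sigma)}\hat\eta^{-2},\qquad \Theta_{\hat\eta}=M+T_{\hat\eta}(\lambda)\|\mathcal A\|^2 .$$ Then the AIP.QP method (described in the context) outputs a pair $([\hat z,\hat p],[\hat v,\hat q])\in[Z\times\mathcal R]\times[\mathcal Z\times\mathcal R]$ satisfying $$\hat v\in\nabla f(\hat z)+\partial h(\hat z)+\mathcal A^*\hat p,\quad \|\hat v\|\le\hat\rho,\quad \mathcal A\hat z+\hat q\in S,\quad\|\hat q\|\le\hat\eta$$ in $$\mathcal O\left(\sqrt{\frac{\lambda\Theta_{\hat\eta}+1}{\min\{\sigma,1-\lambda m\}}}\left[\frac{R^{\mathcal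 F}_\lambda\varphi_{\hat c}(z_0)}{(1-\sigma)^2\lambda^2\hat\rho^2}+\log_1^+(\lambda\Theta_{\hat\eta})\right]\right)$$ inner iterations (i.e. total ACG iterations).
   Context: $\mathcal Z,\mathcal R$ are finite dimensional inner product spaces. $\overline{\mathrm{Conv}}(Z)$: proper lower semicontinuous convex functions $\mathcal Z\to(-\infty,\infty]$ real-valued exactly on $Z$. $\ell_f(u;z)=f(z)+\langle\nabla f(z),u-z\rangle$. $\mathcal C_{m,M}(Z)$: functions continuously differentiable on $Z$ (finite on an open set containing $Z$) with $-\frac m2\|u-z\|^2\le f(u)-\ell_f(u;z)\le\frac M2\|u-z\|^2$ for all $u,z\in Z$. $\Pi_S$ is the projection onto $S$. $\log_1^+(t)=\max\{\log t,1\}$. $\mathcal O(B)$ means at most $C\max\{1,B\}$ for a universal constant $C$. Define $$R^{\mathcal F}_\lambda\psi(z_0)=\inf_{u\in\mathcal F}\left\{\tfrac12\|z_0-u\|^2+\lambda\left[\psi(u)-\inf_{\tilde z\in\mathcal Z}\psi(\tilde z)\right]\right\}.$$ ACG iterations with inputs $(\psi_s,\psi_n,y_0,\mu,L)$: set $\psi=\psi_s+\psi_n$, $A_0=0$, $\Gamma_0\equiv0$, $x_0=y_0$, and for $k=1,2,\dots$: $\tau_{k-1}=(1+\mu A_{k-1})/L$, $a_{k-1}=\frac12\left(\tau_{k-1}+\sqrt{\tau_{k-1}^2+4\tau_{k-1}A_{k-1}}\right)$, $A_k=A_{k-1}+a_{k-1}$, $\tilde x_{k-1}=\frac{A_{k-1}}{A_k}y_{k-1}+\frac{a_{k-1}}{A_k}x_{k-1}$,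 $q_k=\ell_{\psi_s}(\cdot;\tilde x_{k-1})+\psi_n+\frac\mu2\|\cdot-\tilde x_{k-1}\|^2$, $y_k=\operatorname{argmin}_y\{\frac1Lq_k(y)+\frac12\|y-\tilde x_{k-1}\|^2\}$, $x_k=x_{k-1}+\frac{a_{k-1}}{1+\mu A_k}[L(y_k-\tilde x_{k-1})+\mu(y_k-x_{k-1})]$, $\gamma_{k-1}=q_k(y_k)+L\langle\tilde x_{k-1}-y_k,\cdot-y_k\rangle+\frac\mu2\|\cdot-y_k\|^2$, $\Gamma_k=\frac{A_{k-1}}{A_k}\Gamma_{k-1}+\frac{a_{k-1}}{A_k}\gamma_{k-1}$, $r_k=(x_0-x_k)/A_k$, $\eta_k=\psi(y_k)-\Gamma_k(x_k)-\langle r_k,y_k-x_k\rangle$. ACG1 returns $(y_k,r_k,\eta_k)$ at the first $k$ with $\|r_k\|^2+2\eta_k\le\sigma\|y_0-y_k+r_k\|^2$ and $A_k\ge\max\{8,9/\mu\}$. ACG2, with extra input $\bar\eta$, returns $(y_k,r_k,\eta_k)$ at the first $k$ with $\|r_k\|^2+2\eta_k\le\sigma\|y_0-y_k+r_k\|^2$ and $\eta_k\le\bar\eta$. AIPP$(f,h,z_0,\lambda,m,M,\sigma,\hat\rho)$: set $\mu=1-\lambda m$, $L=1+\lambda M$, $\bar\rho=\hat\rho/4$, $\bar\varepsilon=\hat\rho^2/(32[\max\{m,M\}+\lambda^{-1}])$. For $k=1,2,\dots$: let $\psi_s^k=\lambda f+\frac12\|\cdot-z_{k-1}\|^2$; let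 $(z_k,\tilde v_k,\tilde\varepsilon_k)$ be the output of ACG1 with inputs $(\psi_s^k,\lambda h,z_{k-1},\mu,L)$ and $\sigma$. If $\|z_{k-1}-z_k+\tilde v_k\|\le\lambda\bar\rho/5$, then: let $(z,\tilde v,\tilde\varepsilon)$ be the output of ACG2 with the same inputs and $\bar\eta=\lambda\bar\varepsilon$; put $L_\lambda=\max\{m,M\}+\lambda^{-1}$, $\hat z=\operatorname{argmin}_u\{\ell_f(u;z)+h(u)+\frac{L_\lambda}2\|u-z\|^2\}$, $\hat v=L_\lambda(z-\hat z)+\nabla f(\hat z)-\nabla f(z)$; stop and output $(\hat z,\hat v)$. AIP.QP method: set $c_1=\hat c+(M+\lambda^{-1})/\|\mathcal A\|^2$. For $\ell=1,2,\dots$: set $M_{c_\ell}=M+c_\ell\|\mathcal A\|^2$; let $(\hat z_\ell,\hat v_\ell)$ be the output of AIPP$(f_{c_\ell},h,z_0,\lambda,m,M_{c_\ell},\sigma,\hat\rho)$; set $\hat p_\ell=c_\ell[\mathcal A\hat z_\ell-\Pi_S(\mathcal A\hat z_\ell)]$ and $\hat q_\ell=\Pi_S(\mathcal A\hat z_\ell)-\mathcal A\hat z_\ell$; if $\|\hat q_\ell\|\le\hat\eta$, stop and output $([\hat z_\ell,\hat p_\ell],[\hat v_\ell,\hat q_\ell])$; otherwise set $c_{\ell+1}=2c_\ell$.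
   Formalization: Adds: the C_{m,M} bounds hold at every point x̃ where ACG linearizes f (x̃ may leave Z); ∇f is max{m,M}-Lipschitz on Z; R is finite; and ACG2 continues the ACG1 run from its stopping index instead of searching afresh from k=1. Without these the claim can fail. *)

theory Defs
  imports "HOL-Analysis.Analysis"
begin

definition lsc :: "('a::topological_space \<Rightarrow> ereal) \<Rightarrow> bool" where
  "lsc h \<longleftrightarrow> (\<forall>x. h x \<le> Liminf (at x) h)"

definition convex_ereal :: "('a::real_vector \<Rightarrow> ereal) \<Rightarrow> bool" where
  "convex_ereal h \<longleftrightarrow>
     (\<forall>x y. \<forall>t\<in>{0<..<1}.
        h ((1 - t) *\<^sub>R x + t *\<^sub>R y) \<le> ereal (1 - t) * h x + ereal t * h y)"

definition closed_convex_on :: "'a::euclidean_space set \<Rightarrow> ('a \<Rightarrow> ereal) \<Rightarrow> bool" where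
  "closed_convex_on Z h \<longleftrightarrow>
     (\<forall>z. h z \<noteq> -\<infinity>) \<and> (\<exists>z. h z \<noteq> \<infinity>) \<and> lsc h \<and> convex_ereal h \<and> {z. h z < \<infinity>} = Z"

definition subdifferential :: "('a::real_inner \<Rightarrow> ereal) \<Rightarrow> 'a \<Rightarrow> 'a set" where
  "subdifferential h z =
     {v. \<bar>h z\<bar> \<noteq> \<infinity> \<and> (\<forall>u. h z + ereal (v \<bullet> (u - z)) \<le> h u)}"

definition grad :: "('a::real_inner \<Rightarrow> real) \<Rightarrow> 'a \<Rightarrow> 'a" where
  "grad f z = (THE D. GDERIV f z :> D)"

definition linearization :: "('a::real_inner \<Rightarrow> real) \<Rightarrow> 'a \<Rightarrow> 'a \<Rightarrow> real" where
  "linearization f z u = f z + grad f z \<bullet> (u - z)"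

definition curvature_bounds_at ::
    "real \<Rightarrow> real \<Rightarrow> 'a::real_inner set \<Rightarrow> ('a \<Rightarrow> real) \<Rightarrow> 'a \<Rightarrow> bool" where
  "curvature_bounds_at m M Z f z \<longleftrightarrow>
     f differentiable (at z) \<and>
     (\<forall>u\<in>Z. - (m / 2) * (norm (u - z))\<^sup>2 \<le> f u - linearization f z u \<and>
            f u - linearization f z u \<le> M / 2 * (norm (u - z))\<^sup>2)"

text \<open>Functions are total here, so a function that is finite only on an open set containing
  \<open>Z\<close> is represented by any real-valued extension of it. The extension is immaterial for
  the class below, which depends only on \<open>f\<close> near the points of \<open>Z\<close>.\<close>

definition curvature_class ::
    "real \<Rightarrow> real \<Rightarrow> 'a::real_inner set \<Rightarrow> ('a \<Rightarrow> real) \<Rightarrow> bool" where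
  "curvature_class m M Z f \<longleftrightarrow>
     continuous_on Z (grad f) \<and> (\<forall>z\<in>Z. curvature_bounds_at m M Z f z)"

definition argmin :: "('a \<Rightarrow> ereal) \<Rightarrow> 'a" where
  "argmin g = arg_min g (\<lambda>_. True)"

definition prox_gap ::
    "'a::real_normed_vector set \<Rightarrow> real \<Rightarrow> ('a \<Rightarrow> ereal) \<Rightarrow> 'a \<Rightarrow> ereal" where
  "prox_gap F lam \<psi> z0 =
     (INF u\<in>F. ereal ((norm (z0 - u))\<^sup>2 / 2) + ereal lam * (\<psi> u - (INF z. \<psi> z)))"

definition log_plus1 :: "real \<Rightarrow> real" where
  "log_plus1 t = max (ln t) 1"


record 'a acg_state =
  st_A :: real
  st_y :: 'a
  st_x :: 'a
  st_\<Gamma> :: "'a \<Rightarrow> real"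

definition acg_a :: "real \<Rightarrow> real \<Rightarrow> 'a acg_state \<Rightarrow> real" where
  "acg_a \<mu> L s =
     (let A = st_A s; \<tau> = (1 + \<mu> * A) / L in (\<tau> + sqrt (\<tau>\<^sup>2 + 4 * \<tau> * A)) / 2)"

definition acg_xt :: "real \<Rightarrow> real \<Rightarrow> 'a::real_vector acg_state \<Rightarrow> 'a" where
  "acg_xt \<mu> L s =
     (let A = st_A s; a = acg_a \<mu> L s
      in (A / (A + a)) *\<^sub>R st_y s + (a / (A + a)) *\<^sub>R st_x s)"

definition acg_q ::
    "('a::real_inner \<Rightarrow> real) \<Rightarrow> ('a \<Rightarrow> ereal) \<Rightarrow> real \<Rightarrow> 'a \<Rightarrow> 'a \<Rightarrow> ereal" where
  "acg_q \<psi>s \<psi>n \<mu> xt u =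
     ereal (linearization \<psi>s xt u) + \<psi>n u + ereal (\<mu> / 2 * (norm (u - xt))\<^sup>2)"

text \<open>The new iterate \<open>y\<close> lies where \<open>\<psi>n\<close> is finite, so \<^const>\<open>real_of_ereal\<close>
  below and in \<open>acg_eta\<close> is only ever applied to a finite value.\<close>

definition acg_step ::
    "('a::real_inner \<Rightarrow> real) \<Rightarrow> ('a \<Rightarrow> ereal) \<Rightarrow> real \<Rightarrow> real \<Rightarrow> 'a acg_state \<Rightarrow> 'a acg_state" where
  "acg_step \<psi>s \<psi>n \<mu> L s =
     (let A = st_A s; a = acg_a \<mu> L s; A' = A + a; x = st_x s; xt = acg_xt \<mu> L s;
          q = acg_q \<psi>s \<psi>n \<mu> xt;
          y' = argmin (\<lambda>y. ereal (1 / L) * q y + ereal ((norm (y - xt))\<^sup>2 / 2));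
          x' = x + (a / (1 + \<mu> * A')) *\<^sub>R (L *\<^sub>R (y' - xt) + \<mu> *\<^sub>R (y' - x));
          \<gamma> = (\<lambda>u. real_of_ereal (q y') + L * ((xt - y') \<bullet> (u - y'))
                      + \<mu> / 2 * (norm (u - y'))\<^sup>2)
      in \<lparr> st_A = A', st_y = y', st_x = x',
           st_\<Gamma> = (\<lambda>u. A / A' * st_\<Gamma> s u + a / A' * \<gamma> u) \<rparr>)"

primrec acg ::
    "('a::real_inner \<Rightarrow> real) \<Rightarrow> ('a \<Rightarrow> ereal) \<Rightarrow> 'a \<Rightarrow> real \<Rightarrow> real \<Rightarrow> nat \<Rightarrow> 'a acg_state" where
  "acg \<psi>s \<psi>n y0 \<mu> L 0 = \<lparr> st_A = 0, st_y = y0, st_x = y0, st_\<Gamma> = (\<lambda>_. 0) \<rparr>"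
| "acg \<psi>s \<psi>n y0 \<mu> L (Suc k) = acg_step \<psi>s \<psi>n \<mu> L (acg \<psi>s \<psi>n y0 \<mu> L k)"

definition acg_r :: "'a::real_vector \<Rightarrow> 'a acg_state \<Rightarrow> 'a" where
  "acg_r y0 s = (1 / st_A s) *\<^sub>R (y0 - st_x s)"

definition acg_eta ::
    "('a::real_inner \<Rightarrow> real) \<Rightarrow> ('a \<Rightarrow> ereal) \<Rightarrow> 'a \<Rightarrow> 'a acg_state \<Rightarrow> real" where
  "acg_eta \<psi>s \<psi>n y0 s =
     real_of_ereal (ereal (\<psi>s (st_y s)) + \<psi>n (st_y s)) - st_\<Gamma> s (st_x s)
       - acg_r y0 s \<bullet> (st_y s - st_x s)"

definition acg_rel_error ::
    "('a::real_inner \<Rightarrow> real) \<Rightarrow> ('a \<Rightarrow> ereal) \<Rightarrow> 'a \<Rightarrow> real \<Rightarrow> 'a acg_state \<Rightarrow> bool" where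
  "acg_rel_error \<psi>s \<psi>n y0 \<sigma> s \<longleftrightarrow>
     (norm (acg_r y0 s))\<^sup>2 + 2 * acg_eta \<psi>s \<psi>n y0 s
       \<le> \<sigma> * (norm (y0 - st_y s + acg_r y0 s))\<^sup>2"

definition first_from :: "nat \<Rightarrow> (nat \<Rightarrow> bool) \<Rightarrow> nat \<Rightarrow> bool" where
  "first_from k0 P k \<longleftrightarrow> k0 \<le> k \<and> P k \<and> (\<forall>j. k0 \<le> j \<and> j < k \<longrightarrow> \<not> P j)"

definition acg1_stops ::
    "('a::real_inner \<Rightarrow> real) \<Rightarrow> ('a \<Rightarrow> ereal) \<Rightarrow> 'a \<Rightarrow> real \<Rightarrow> real \<Rightarrow> real \<Rightarrow> nat \<Rightarrow> bool" where
  "acg1_stops \<psi>s \<psi>n y0 \<mu> L \<sigma> k \<longleftrightarrow>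
     first_from 1 (\<lambda>k. acg_rel_error \<psi>s \<psi>n y0 \<sigma> (acg \<psi>s \<psi>n y0 \<mu> L k) \<and>
                       st_A (acg \<psi>s \<psi>n y0 \<mu> L k) \<ge> max 8 (9 / \<mu>)) k"

text \<open>The second variant resumes, from index \<open>k0\<close>, the iteration at which the first variant
  stopped on the same inputs. If it were allowed to stop at an earlier index, its output could
  have a much larger residual than the one tested in the outer method, and the
  accuracy guarantee of the outer method would fail for \<open>\<sigma>\<close> close to 1.\<close>

definition acg2_stops ::
    "('a::real_inner \<Rightarrow> real) \<Rightarrow> ('a \<Rightarrow> ereal) \<Rightarrow> 'a \<Rightarrow> real \<Rightarrow> real \<Rightarrow> real \<Rightarrow> real \<Rightarrow>
      nat \<Rightarrow> nat \<Rightarrow> bool" where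
  "acg2_stops \<psi>s \<psi>n y0 \<mu> L \<sigma> \<eta>bar k0 k \<longleftrightarrow>
     first_from k0 (\<lambda>k. acg_rel_error \<psi>s \<psi>n y0 \<sigma> (acg \<psi>s \<psi>n y0 \<mu> L k) \<and>
                        acg_eta \<psi>s \<psi>n y0 (acg \<psi>s \<psi>n y0 \<mu> L k) \<le> \<eta>bar) k"


definition prox_smooth :: "('a::real_inner \<Rightarrow> real) \<Rightarrow> real \<Rightarrow> 'a \<Rightarrow> 'a \<Rightarrow> real" where
  "prox_smooth f lam z u = lam * f u + (norm (u - z))\<^sup>2 / 2"

definition scaled :: "real \<Rightarrow> ('a \<Rightarrow> ereal) \<Rightarrow> 'a \<Rightarrow> ereal" where
  "scaled lam h u = ereal lam * h u"

definition aipp_acg ::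
    "('a::real_inner \<Rightarrow> real) \<Rightarrow> ('a \<Rightarrow> ereal) \<Rightarrow> real \<Rightarrow> real \<Rightarrow> real \<Rightarrow> 'a \<Rightarrow> nat \<Rightarrow> 'a acg_state" where
  "aipp_acg f h lam m M z =
     acg (prox_smooth f lam z) (scaled lam h) z (1 - lam * m) (1 + lam * M)"

definition aipp_call1 ::
    "('a::real_inner \<Rightarrow> real) \<Rightarrow> ('a \<Rightarrow> ereal) \<Rightarrow> real \<Rightarrow> real \<Rightarrow> real \<Rightarrow> real \<Rightarrow>
      'a \<Rightarrow> nat \<Rightarrow> bool" where
  "aipp_call1 f h lam m M \<sigma> z k \<longleftrightarrow>
     acg1_stops (prox_smooth f lam z) (scaled lam h) z (1 - lam * m) (1 + lam * M) \<sigma> k"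

definition aipp_call2 ::
    "('a::real_inner \<Rightarrow> real) \<Rightarrow> ('a \<Rightarrow> ereal) \<Rightarrow> real \<Rightarrow> real \<Rightarrow> real \<Rightarrow> real \<Rightarrow> real \<Rightarrow>
      'a \<Rightarrow> nat \<Rightarrow> nat \<Rightarrow> bool" where
  "aipp_call2 f h lam m M \<sigma> \<rho> z k0 k \<longleftrightarrow>
     (let \<epsilon>bar = \<rho>\<^sup>2 / (32 * (max m M + 1 / lam))
      in acg2_stops (prox_smooth f lam z) (scaled lam h) z (1 - lam * m) (1 + lam * M) \<sigma>
           (lam * \<epsilon>bar) k0 k)"

definition aipp_small_residual ::
    "real \<Rightarrow> real \<Rightarrow> 'a::real_normed_vector \<Rightarrow> 'a acg_state \<Rightarrow> bool" where
  "aipp_small_residual lam \<rho> z s \<longleftrightarrow>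
     (let \<rho>bar = \<rho> / 4 in norm (z - st_y s + acg_r z s) \<le> lam * \<rho>bar / 5)"

definition refine_z ::
    "('a::real_inner \<Rightarrow> real) \<Rightarrow> ('a \<Rightarrow> ereal) \<Rightarrow> real \<Rightarrow> 'a \<Rightarrow> 'a" where
  "refine_z f h Llam z =
     argmin (\<lambda>u. ereal (linearization f z u) + h u + ereal (Llam / 2 * (norm (u - z))\<^sup>2))"

definition refine_v ::
    "('a::real_inner \<Rightarrow> real) \<Rightarrow> ('a \<Rightarrow> ereal) \<Rightarrow> real \<Rightarrow> 'a \<Rightarrow> 'a" where
  "refine_v f h Llam z =
     Llam *\<^sub>R (z - refine_z f h Llam z) + grad f (refine_z f h Llam z) - grad f z"

text \<open>\<open>aipp_run \<dots> z zv n\<close>: the outer loop, entered with prox centre \<open>z\<close>, terminates with output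
  \<open>zv\<close> after a total of \<open>n\<close> ACG iterations. The resumed call is charged from its beginning.\<close>

inductive aipp_run ::
    "('a::real_inner \<Rightarrow> real) \<Rightarrow> ('a \<Rightarrow> ereal) \<Rightarrow> real \<Rightarrow> real \<Rightarrow> real \<Rightarrow> real \<Rightarrow> real \<Rightarrow>
      'a \<Rightarrow> 'a \<times> 'a \<Rightarrow> nat \<Rightarrow> bool"
  for f h lam m M \<sigma> \<rho> where
  aipp_continue:
    "\<lbrakk> aipp_call1 f h lam m M \<sigma> z k;
       \<not> aipp_small_residual lam \<rho> z (aipp_acg f h lam m M z k);
       aipp_run f h lam m M \<sigma> \<rho> (st_y (aipp_acg f h lam m M z k)) zv n \<rbrakk>
     \<Longrightarrow> aipp_run f h lam m M \<sigma> \<rho> z zv (k + n)"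
| aipp_finish:
    "\<lbrakk> aipp_call1 f h lam m M \<sigma> z k;
       aipp_small_residual lam \<rho> z (aipp_acg f h lam m M z k);
       aipp_call2 f h lam m M \<sigma> \<rho> z k k';
       z' = st_y (aipp_acg f h lam m M z k');
       Llam = max m M + 1 / lam \<rbrakk>
     \<Longrightarrow> aipp_run f h lam m M \<sigma> \<rho> z (refine_z f h Llam z', refine_v f h Llam z') (k + k')"

text \<open>The prox centres that the outer loop, started at \<open>z0\<close>, passes to ACG.\<close>

inductive aipp_centre ::
    "('a::real_inner \<Rightarrow> real) \<Rightarrow> ('a \<Rightarrow> ereal) \<Rightarrow> real \<Rightarrow> real \<Rightarrow> real \<Rightarrow> real \<Rightarrow> real \<Rightarrow>
      'a \<Rightarrow> 'a \<Rightarrow> bool"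
  for f h lam m M \<sigma> \<rho> z0 where
  "aipp_centre f h lam m M \<sigma> \<rho> z0 z0"
| "\<lbrakk> aipp_centre f h lam m M \<sigma> \<rho> z0 z;
     aipp_call1 f h lam m M \<sigma> z k;
     \<not> aipp_small_residual lam \<rho> z (aipp_acg f h lam m M z k) \<rbrakk>
   \<Longrightarrow> aipp_centre f h lam m M \<sigma> \<rho> z0 (st_y (aipp_acg f h lam m M z k))"


definition penalized ::
    "('a \<Rightarrow> real) \<Rightarrow> ('a \<Rightarrow> 'b::metric_space) \<Rightarrow> 'b set \<Rightarrow> real \<Rightarrow> 'a \<Rightarrow> real" where
  "penalized f A S c z = f z + c / 2 * (infdist (A z) S)\<^sup>2"

definition penalized_obj ::
    "('a \<Rightarrow> real) \<Rightarrow> ('a \<Rightarrow> ereal) \<Rightarrow> ('a \<Rightarrow> 'b::metric_space) \<Rightarrow> 'b set \<Rightarrow> real \<Rightarrow>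
      'a \<Rightarrow> ereal" where
  "penalized_obj f h A S c z = ereal (penalized f A S c z) + h z"

definition aipqp_c1 ::
    "('a::real_normed_vector \<Rightarrow> 'b::real_normed_vector) \<Rightarrow> real \<Rightarrow> real \<Rightarrow> real \<Rightarrow> real" where
  "aipqp_c1 A chat M lam = chat + (M + 1 / lam) / (onorm A)\<^sup>2"

definition infeasibility ::
    "('a \<Rightarrow> 'b::euclidean_space) \<Rightarrow> 'b set \<Rightarrow> 'a \<Rightarrow> 'b" where
  "infeasibility A S z = closest_point S (A z) - A z"

definition multiplier ::
    "('a \<Rightarrow> 'b::euclidean_space) \<Rightarrow> 'b set \<Rightarrow> real \<Rightarrow> 'a \<Rightarrow> 'b" where
  "multiplier A S c z = c *\<^sub>R (A z - closest_point S (A z))"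

text \<open>\<open>aipqp_run \<dots> c ((z, p), (v, q)) n\<close>: the penalty loop, entered with penalty parameter \<open>c\<close>,
  terminates with that output after a total of \<open>n\<close> ACG iterations.\<close>

inductive aipqp_run ::
    "('a::euclidean_space \<Rightarrow> real) \<Rightarrow> ('a \<Rightarrow> ereal) \<Rightarrow> ('a \<Rightarrow> 'b::euclidean_space) \<Rightarrow> 'b set \<Rightarrow>
      real \<Rightarrow> real \<Rightarrow> real \<Rightarrow> real \<Rightarrow> real \<Rightarrow> real \<Rightarrow> 'a \<Rightarrow>
      real \<Rightarrow> ('a \<times> 'b) \<times> ('a \<times> 'b) \<Rightarrow> nat \<Rightarrow> bool"
  for f h A S lam m M \<sigma> \<rho> \<eta> z0 where
  aipqp_finish:
    "\<lbrakk> aipp_run (penalized f A S c) h lam m (M + c * (onorm A)\<^sup>2) \<sigma> \<rho> z0 (z, v) n;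
       norm (infeasibility A S z) \<le> \<eta> \<rbrakk>
     \<Longrightarrow> aipqp_run f h A S lam m M \<sigma> \<rho> \<eta> z0 c
           ((z, multiplier A S c z), (v, infeasibility A S z)) n"
| aipqp_continue:
    "\<lbrakk> aipp_run (penalized f A S c) h lam m (M + c * (onorm A)\<^sup>2) \<sigma> \<rho> z0 (z, v) n;
       \<not> norm (infeasibility A S z) \<le> \<eta>;
       aipqp_run f h A S lam m M \<sigma> \<rho> \<eta> z0 (2 * c) out n' \<rbrakk>
     \<Longrightarrow> aipqp_run f h A S lam m M \<sigma> \<rho> \<eta> z0 c out (n + n')"

text \<open>The penalty parameters that the loop, started with \<open>c1\<close>, passes to the inner method.\<close>

inductive aipqp_penalty ::
    "('a::euclidean_space \<Rightarrow> real) \<Rightarrow> ('a \<Rightarrow> ereal) \<Rightarrow> ('a \<Rightarrow> 'b::euclidean_space) \<Rightarrow> 'b set \<Rightarrow>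
      real \<Rightarrow> real \<Rightarrow> real \<Rightarrow> real \<Rightarrow> real \<Rightarrow> real \<Rightarrow> 'a \<Rightarrow> real \<Rightarrow> real \<Rightarrow> bool"
  for f h A S lam m M \<sigma> \<rho> \<eta> z0 c1 where
  "aipqp_penalty f h A S lam m M \<sigma> \<rho> \<eta> z0 c1 c1"
| "\<lbrakk> aipqp_penalty f h A S lam m M \<sigma> \<rho> \<eta> z0 c1 c;
     aipp_run (penalized f A S c) h lam m (M + c * (onorm A)\<^sup>2) \<sigma> \<rho> z0 (z, v) n;
     \<not> norm (infeasibility A S z) \<le> \<eta> \<rbrakk>
   \<Longrightarrow> aipqp_penalty f h A S lam m M \<sigma> \<rho> \<eta> z0 c1 (2 * c)"

text \<open>The points at which the method linearizes \<open>f\<close> inside ACG. These are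
  extrapolations of the iterates and need not belong to \<open>Z\<close>.\<close>

definition linearization_points ::
    "('a::euclidean_space \<Rightarrow> real) \<Rightarrow> ('a \<Rightarrow> ereal) \<Rightarrow> ('a \<Rightarrow> 'b::euclidean_space) \<Rightarrow> 'b set \<Rightarrow>
      real \<Rightarrow> real \<Rightarrow> real \<Rightarrow> real \<Rightarrow> real \<Rightarrow> real \<Rightarrow> 'a \<Rightarrow> real \<Rightarrow> 'a set" where
  "linearization_points f h A S lam m M \<sigma> \<rho> \<eta> z0 c1 =
     {acg_xt (1 - lam * m) (1 + lam * Mc) (aipp_acg (penalized f A S c) h lam m Mc z k) | c Mc z k.
        aipqp_penalty f h A S lam m M \<sigma> \<rho> \<eta> z0 c1 c \<and> Mc = M + c * (onorm A)\<^sup>2 \<and>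
        aipp_centre (penalized f A S c) h lam m Mc \<sigma> \<rho> z0 z}"

definition T_bound :: "real \<Rightarrow> real \<Rightarrow> real \<Rightarrow> real \<Rightarrow> real \<Rightarrow> real" where
  "T_bound chat R \<eta> lam \<sigma> = chat + 2 * R / (lam * (1 - \<sigma>)) / \<eta>\<^sup>2"

definition iteration_bound ::
    "real \<Rightarrow> real \<Rightarrow> real \<Rightarrow> real \<Rightarrow> real \<Rightarrow> real \<Rightarrow> real" where
  "iteration_bound \<Theta> R lam m \<sigma> \<rho> =
     sqrt ((lam * \<Theta> + 1) / min \<sigma> (1 - lam * m)) *
       (R / ((1 - \<sigma>)\<^sup>2 * lam\<^sup>2 * \<rho>\<^sup>2) + log_plus1 (lam * \<Theta>))"

text \<open>The universal constant hidden in the \<open>\<O>\<close> notation. It must not depend on the spaces, which are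
  types here, and HOL cannot quantify over types inside the scope of an existential
  quantifier; hence a numeral instead of an existentially quantified constant.\<close>

definition universal_const :: real where
  "universal_const = 10 ^ 6"

end

theory Submission
  imports Defs
begin

text \<open>ACG is analysed through its estimate sequence: \<open>A\<^sub>k \<Gamma>\<^sub>k + \<parallel>\<cdot> - x\<^sub>0\<parallel>\<^sup>2 / 2\<close> is a
  quadratic centred at \<open>x\<^sub>k\<close> whose minimum dominates \<open>A\<^sub>k \<psi>(y\<^sub>k)\<close>, while \<open>\<Gamma>\<^sub>k \<le> \<psi>\<close>. Hence
  \<open>\<parallel>A\<^sub>k r\<^sub>k + y\<^sub>k - x\<^sub>0\<parallel>\<^sup>2 + 2 A\<^sub>k \<eta>\<^sub>k \<le> \<parallel>y\<^sub>k - x\<^sub>0\<parallel>\<^sup>2\<close>, so the relative error test succeeds once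
  \<open>A\<^sub>k \<ge> 9/\<sigma>\<close>, after \<open>O(sqrt(L/\<sigma>))\<close> steps, and the test \<open>\<eta>\<^sub>k \<le> \<lambda>\<epsilon>\<close> once \<open>A\<^sub>k \<ge> L\<close>, which the
  geometric growth of \<open>A\<^sub>k\<close> reaches after \<open>O(sqrt(L/\<mu>) log L)\<close> steps.

  In the outer method each non-final step lowers the objective by a fixed amount, and the first
  iterate is already bounded by \<open>R/(1 - \<sigma>)\<close> above the infimum. The same bound on the objective
  forces \<open>dist(A z, S) \<le> \<eta>\<close> once \<open>c \<ge> T\<close>. As \<open>c\<close> doubles and the cost for \<open>c\<close> grows like
  \<open>sqrt c\<close>, the total cost is dominated by the last penalty parameter, which is at most
  \<open>max c\<^sub>1 (2 T)\<close>.\<close>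

section \<open>Closed convex functions and proximal steps\<close>

text \<open>The tolerance of the resumed ACG call does not enter its logarithm. That call is made
  only when the residual is at most \<open>lam * \<rho> / 20\<close>; the distance to the centre
  then stays within three times that, and the tolerance is proportional to
  \<open>(lam * \<rho>)\<^sup>2 / L\<close>, so \<open>A k \<ge> L\<close> suffices for every
  \<open>\<rho>\<close>. The number 20 = 4 * 5 lets the residual grow fivefold while the call runs
  on.

  Two obstacles shape the statements. ACG linearizes at extrapolated points that may leave
  \<open>Z\<close>, so curvature at those points is a hypothesis of its own. The infimum
  \<open>R\<close> may not be attained, so every bound is proved against each feasible point and
  only then passed to \<open>R\<close>.

  The square of 1 - \<sigma> has two sources: comparing the first prox step with an arbitrary point
  loses 1/(1 - \<sigma>), and each later drop of the objective carries a factor 1 - \<sigma>. The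
  starting penalty makes \<open>c * (onorm A)\<^sup>2\<close> dominate \<open>M + 1 / lam\<close>,
  which is what lets the cost of one run scale with sqrt c.\<close>

lemma norm_add_sq:
  fixes x y :: "'a::real_inner"
  shows "(norm (x + y))\<^sup>2 = (norm x)\<^sup>2 + 2 * (x \<bullet> y) + (norm y)\<^sup>2"
  by (simp add: power2_norm_eq_inner algebra_simps inner_commute)

lemma norm_diff_sq:
  fixes x y :: "'a::real_inner"
  shows "(norm (x - y))\<^sup>2 = (norm x)\<^sup>2 - 2 * (x \<bullet> y) + (norm y)\<^sup>2"
  by (simp add: power2_norm_eq_inner algebra_simps inner_commute)

definition real_part :: "('a \<Rightarrow> ereal) \<Rightarrow> 'a \<Rightarrow> real" where
  "real_part h u = real_of_ereal (h u)"

context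
  fixes Z :: "'a::euclidean_space set" and h :: "'a \<Rightarrow> ereal"
  assumes h: "closed_convex_on Z h"
begin

lemma closed_convex_on_finite: "u \<in> Z \<Longrightarrow> h u = ereal (real_part h u)"
  using h unfolding closed_convex_on_def real_part_def
  by (metis (mono_tags, lifting) ereal_infty_less(1) ereal_real' abs_ereal.elims ereal_infinity_cases mem_Collect_eq)

lemma closed_convex_on_infinite: "u \<notin> Z \<Longrightarrow> h u = \<infinity>"
  using h unfolding closed_convex_on_def by (metis (mono_tags, lifting) ereal_infty_less(1) mem_Collect_eq)

lemma closed_convex_on_segment:
  assumes "x \<in> Z" "y \<in> Z" "0 < t" "t < 1"
  shows "(1 - t) *\<^sub>R x + t *\<^sub>R y \<in> Z"
    and "real_part h ((1 - t) *\<^sub>R x + t *\<^sub>R y) \<le> (1 - t) * real_part h x + t * real_part h y"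
proof -
  let ?w = "(1 - t) *\<^sub>R x + t *\<^sub>R y"
  have "h ?w \<le> ereal (1 - t) * h x + ereal t * h y"
    using h assms unfolding closed_convex_on_def convex_ereal_def by auto
  then have le: "h ?w \<le> ereal ((1 - t) * real_part h x + t * real_part h y)"
    using closed_convex_on_finite[OF assms(1)] closed_convex_on_finite[OF assms(2)] by simp
  show "?w \<in> Z"
    using le closed_convex_on_infinite[of ?w] by force
  from closed_convex_on_finite[OF this] le
  show "real_part h ?w \<le> (1 - t) * real_part h x + t * real_part h y" by simp
qed

text \<open>The level may vary continuously because a sublevel set of \<open>h\<close> plus a
  quadratic has exactly this form; semicontinuity of such sums never has to be stated.\<close>

lemma closed_convex_on_sublevel_closed:
  assumes p: "continuous_on UNIV p"
  shows "closed {u. h u \<le> ereal (p u)}"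
proof -
  have "open {u. h u > ereal (p u)}"
  proof (subst open_subopen, safe)
    fix x assume x: "ereal (p x) < h x"
    then obtain s where s: "ereal (p x) < ereal s" "ereal s < h x"
      using ereal_dense2 by blast
    have "h x \<le> Liminf (at x) h" using h unfolding closed_convex_on_def lsc_def by auto
    then have "eventually (\<lambda>u. ereal s < h u) (at x)"
      using s(2) by (intro less_LiminfD) auto
    then have "eventually (\<lambda>u. ereal s < h u) (nhds x)"
      using s(2) by (simp add: eventually_nhds_conv_at)
    moreover have "eventually (\<lambda>u. p u < s) (nhds x)"
      using p s(1) by (intro order_tendstoD(2)[of p "p x"])
        (auto simp: continuous_on_eq_continuous_at isCont_def tendsto_at_iff_tendsto_nhds)
    ultimately have "eventually (\<lambda>u. ereal (p u) < h u) (nhds x)"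
      by eventually_elim (meson ereal_less_eq(3) less_eq_ereal_def less_ereal.simps(1) less_trans)
    then show "\<exists>T. open T \<and> x \<in> T \<and> T \<subseteq> {u. ereal (p u) < h u}"
      unfolding eventually_nhds by blast
  qed
  moreover have "{u. h u \<le> ereal (p u)} = - {u. h u > ereal (p u)}" by auto
  ultimately show ?thesis by (simp add: closed_def)
qed

text \<open>Lower semicontinuity bounds \<open>h\<close> below on a compact ball, and convexity
  propagates the bound: a very low value far away would pull down the point of the ball on the way
  to it. This replaces the affine minorant obtained by separation and makes prox objectives
  coercive.\<close>

lemma closed_convex_on_linear_minorant:
  "\<exists>b\<ge>0. \<forall>u\<in>Z. real_part h u \<ge> - b * (1 + norm (u - w))"
proof -
  obtain z where z: "z \<in> Z"
    using h unfolding closed_convex_on_def using ereal_infty_less(1) by blast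
  have "\<exists>B. \<forall>u\<in>cball z 1. h u > ereal (- B)"
  proof (rule ccontr)
    assume *: "\<nexists>B. \<forall>u\<in>cball z 1. h u > ereal (- B)"
    \<comment> \<open>A common point of these nested compact sets would have value
      -\<infinity>.\<close>
    define K where "K n = cball z 1 \<inter> {u. h u \<le> ereal (- real n)}" for n :: nat
    have "\<Inter> (range K) \<noteq> {}"
    proof (rule compact_nest)
      fix n show "compact (K n)" unfolding K_def
        by (intro compact_Int_closed closed_convex_on_sublevel_closed) auto
      show "K n \<noteq> {}" using * unfolding K_def by (force simp: not_less)
    next
      fix i j :: nat assume "i \<le> j"
      then have "ereal (- real j) \<le> ereal (- real i)" by simp
      then show "K j \<subseteq> K i" unfolding K_def using order_trans by blast
    qed
    then obtain u where u: "\<And>n. u \<in> K n" by blast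
    have "h u = - \<infinity>"
    proof (rule ereal_bot)
      fix r :: real
      obtain n where "- r < real n" using reals_Archimedean2 by blast
      then have "ereal (- real n) \<le> ereal r" by simp
      with u[of n] show "h u \<le> ereal r" unfolding K_def by (auto intro: order_trans)
    qed
    then show False using h unfolding closed_convex_on_def by auto
  qed
  then obtain B where B: "\<And>u. u \<in> cball z 1 \<Longrightarrow> h u > ereal (- B)" by blast
  have B': "real_part h u \<ge> - \<bar>B\<bar>" if "u \<in> Z" "norm (u - z) \<le> 1" for u
    using B[of u] that closed_convex_on_finite[of u] by (auto simp: dist_norm norm_minus_commute)
  define b where "b = \<bar>B\<bar> + \<bar>real_part h z\<bar>"
  have b0: "b \<ge> 0" by (simp add: b_def)
  have main: "real_part h u \<ge> - b * (1 + norm (u - z))" if u: "u \<in> Z" for u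
  proof (cases "norm (u - z) \<le> 1")
    case True
    have "b * 1 \<le> b * (1 + norm (u - z))" by (intro mult_left_mono) (auto simp: b0)
    moreover have "- b \<le> real_part h u" using B'[OF u True] by (simp add: b_def)
    moreover have "- b * (1 + norm (u - z)) = - (b * (1 + norm (u - z)))" by simp
    ultimately show ?thesis by linarith
  next
    case False
    define d where "d = norm (u - z)"
    \<comment> \<open>This weight puts \<open>?w\<close> at distance exactly 1 from
      \<open>z\<close>, inside the ball already treated.\<close>
    define t where "t = 1 / d"
    have d: "d > 1" using False by (simp add: d_def)
    then have t: "0 < t" "t < 1" by (auto simp: t_def)
    let ?w = "(1 - t) *\<^sub>R z + t *\<^sub>R u"
    have "?w - z = t *\<^sub>R (u - z)" by (simp add: algebra_simps)
    moreover have "norm (t *\<^sub>R (u - z)) = t * d" using t by (simp add: d_def)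
    moreover have "t * d = 1" using d unfolding t_def by simp
    ultimately have n: "norm (?w - z) \<le> 1" by (metis order_refl)
    have "- \<bar>B\<bar> \<le> (1 - t) * real_part h z + t * real_part h u"
      using closed_convex_on_segment(2)[OF z u t] B'[OF closed_convex_on_segment(1)[OF z u t] n]
      by linarith
    moreover have "(1 - t) * real_part h z \<le> (1 - t) * \<bar>real_part h z\<bar>"
      using t by (intro mult_left_mono) auto
    moreover have "(1 - t) * \<bar>real_part h z\<bar> \<le> 1 * \<bar>real_part h z\<bar>"
      using t by (intro mult_right_mono) auto
    ultimately have "- b \<le> t * real_part h u" by (simp add: b_def)
    then have "- b * d \<le> real_part h u" using d by (simp add: t_def field_simps)
    moreover have "b * d \<le> b * (1 + d)" by (intro mult_left_mono) (auto simp: b0)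
    ultimately show ?thesis by (simp add: d_def)
  qed
  have "real_part h u \<ge> - (b * (1 + norm (z - w))) * (1 + norm (u - w))" if u: "u \<in> Z" for u
  proof -
    have "norm (u - z) \<le> norm (z - w) + norm (u - w)"
      using norm_triangle_ineq4[of "u - w" "z - w"] by simp
    moreover have "0 \<le> norm (z - w) * norm (u - w)" by simp
    ultimately have "1 + norm (u - z) \<le> (1 + norm (z - w)) * (1 + norm (u - w))"
      by (simp only: distrib_left distrib_right)
    then have "b * (1 + norm (u - z)) \<le> b * ((1 + norm (z - w)) * (1 + norm (u - w)))"
      using b0 by (intro mult_left_mono) auto
    with main[OF u] show ?thesis by (simp add: algebra_simps)
  qed
  moreover have "b * (1 + norm (z - w)) \<ge> 0" using b0 by simp
  ultimately show ?thesis by blast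
qed

text \<open>The last conclusion is the three-point inequality: the minimized function is strongly
  convex with modulus \<open>\<beta>\<close>, so it grows quadratically away from its minimizer.\<close>

lemma prox_argmin:
  assumes \<alpha>: "\<alpha> > 0" and \<beta>: "\<beta> > 0"
    and g: "\<And>u. g u = ereal \<alpha> * h u + ereal (c + v \<bullet> (u - w) + \<beta> / 2 * (norm (u - w))\<^sup>2)"
    and G: "\<And>u. G u = \<alpha> * real_part h u + (c + v \<bullet> (u - w) + \<beta> / 2 * (norm (u - w))\<^sup>2)"
  shows "argmin g \<in> Z"
    and "u \<in> Z \<Longrightarrow> G (argmin g) + \<beta> / 2 * (norm (u - argmin g))\<^sup>2 \<le> G u"
proof -
  define p where "p u = c + v \<bullet> (u - w) + \<beta> / 2 * (norm (u - w))\<^sup>2" for u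
  have Gp: "G u = \<alpha> * real_part h u + p u" for u using G p_def by simp
  obtain b where b: "b \<ge> 0" "\<And>u. u \<in> Z \<Longrightarrow> real_part h u \<ge> - b * (1 + norm (u - w))"
    using closed_convex_on_linear_minorant[of w] by blast
  define k where "k = \<alpha> * b + norm v"
  have k: "k \<ge> 0" using b \<alpha> by (simp add: k_def)
  have low: "G u \<ge> c - \<alpha> * b - k * norm (u - w) + \<beta> / 2 * (norm (u - w))\<^sup>2" if "u \<in> Z" for u
  proof -
    have "\<alpha> * real_part h u \<ge> \<alpha> * (- b * (1 + norm (u - w)))"
      using b(2)[OF that] \<alpha> by (intro mult_left_mono) auto
    moreover have "v \<bullet> (u - w) \<ge> - (norm v * norm (u - w))"
      using Cauchy_Schwarz_ineq2[of v "u - w"] by (simp add: abs_le_iff)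
    ultimately show ?thesis unfolding Gp p_def k_def by (simp add: algebra_simps)
  qed
  define S where "S r = {u \<in> Z. G u \<le> r}" for r
  have S_eq: "S r = {u. h u \<le> ereal ((r - p u) / \<alpha>)}" for r
  proof (intro set_eqI)
    fix u show "u \<in> S r \<longleftrightarrow> u \<in> {u. h u \<le> ereal ((r - p u) / \<alpha>)}"
    proof (cases "u \<in> Z")
      case True
      then show ?thesis using closed_convex_on_finite[of u] \<alpha>
        by (simp add: S_def Gp field_simps)
    next
      case False
      then show ?thesis using closed_convex_on_infinite[of u] by (simp add: S_def)
    qed
  qed
  have "closed (S r)" for r
    unfolding S_eq p_def using \<alpha>
    by (intro closed_convex_on_sublevel_closed continuous_intros) auto
  moreover have "bounded (S r)" for r
  proof -
    define B where "B = 1 + 2 * (\<bar>r - c + \<alpha> * b\<bar> + k) / \<beta>"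
    have "norm (u - w) \<le> B" if u: "u \<in> S r" for u
    proof (cases "norm (u - w) \<le> 1")
      case True
      have "2 * (\<bar>r - c + \<alpha> * b\<bar> + k) / \<beta> \<ge> 0" using k \<beta> by simp
      then show ?thesis using True unfolding B_def by linarith
    next
      case False
      define d where "d = norm (u - w)"
      have d: "d > 1" using False by (simp add: d_def)
      have "\<beta> / 2 * d\<^sup>2 \<le> (r - c + \<alpha> * b) + k * d"
        using low[of u] u by (simp add: S_def d_def)
      also have "\<dots> \<le> \<bar>r - c + \<alpha> * b\<bar> * d + k * d"
        using d mult_left_mono[of 1 d "\<bar>r - c + \<alpha> * b\<bar>"] by simp
      finally have "(\<beta> / 2 * d) * d \<le> (\<bar>r - c + \<alpha> * b\<bar> + k) * d"
        by (simp add: power2_eq_square algebra_simps)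
      then have "\<beta> / 2 * d \<le> \<bar>r - c + \<alpha> * b\<bar> + k" using d by simp
      then have "d \<le> 2 * (\<bar>r - c + \<alpha> * b\<bar> + k) / \<beta>" using \<beta> by (simp add: field_simps)
      then show ?thesis by (simp add: B_def d_def)
    qed
    then have "S r \<subseteq> cball w B" by (auto simp: dist_norm norm_minus_commute)
    then show ?thesis using bounded_cball bounded_subset by blast
  qed
  ultimately have S_compact: "compact (S r)" for r by (simp add: compact_eq_bounded_closed)
  have below: "c - \<alpha> * b - k\<^sup>2 / (2 * \<beta>) \<le> G u" if "u \<in> Z" for u
  proof -
    have "(\<beta> * norm (u - w) - k)\<^sup>2 / (2 * \<beta>) \<ge> 0" using \<beta> by simp
    then have "- k * norm (u - w) + \<beta> / 2 * (norm (u - w))\<^sup>2 \<ge> - (k\<^sup>2 / (2 * \<beta>))"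
      using \<beta> by (simp add: power2_eq_square field_simps)
    then show ?thesis using low[OF that] by linarith
  qed
  have bdd: "bdd_below (G ` Z)"
    by (rule bdd_belowI2[where f = G, OF below])
  have Z: "Z \<noteq> {}" using h unfolding closed_convex_on_def using ereal_infty_less(1) by blast
  define I where "I = Inf (G ` Z)"
  \<comment> \<open>A minimizer is a common point of the compact sublevel sets at levels decreasing
    to the infimum.\<close>
  have "\<Inter> (range (\<lambda>n. S (I + 1 / real (Suc n)))) \<noteq> {}"
  proof (rule compact_nest)
    fix n show "compact (S (I + 1 / real (Suc n)))" by (rule S_compact)
    have "Inf (G ` Z) < I + 1 / real (Suc n)" by (simp add: I_def)
    then obtain u where "u \<in> Z" "G u < I + 1 / real (Suc n)"
      using Z cInf_lessD[of "G ` Z"] by blast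
    then have "u \<in> S (I + 1 / real (Suc n))" by (simp add: S_def)
    then show "S (I + 1 / real (Suc n)) \<noteq> {}" by blast
  next
    fix i j :: nat assume "i \<le> j"
    then have "1 / real (Suc j) \<le> 1 / real (Suc i)" by (simp add: frac_le)
    then show "S (I + 1 / real (Suc j)) \<subseteq> S (I + 1 / real (Suc i))"
      unfolding S_def by fastforce
  qed
  then obtain y0 where y0: "\<And>n. y0 \<in> S (I + 1 / real (Suc n))" by blast
  have y0Z: "y0 \<in> Z" using y0[of 0] by (simp add: S_def)
  have "G y0 \<le> I"
  proof (rule field_le_epsilon)
    fix e :: real assume "0 < e"
    then obtain n where "1 / real (Suc n) < e" using nat_approx_posE by blast
    then show "G y0 \<le> I + e" using y0[of n] by (simp add: S_def)
  qed
  then have min0: "G y0 \<le> G u" if "u \<in> Z" for u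
    using cInf_lower[of "G u" "G ` Z"] bdd that unfolding I_def by fastforce
  have gG: "g u = ereal (G u)" if "u \<in> Z" for u
    using that closed_convex_on_finite[of u] by (simp add: g Gp p_def)
  have g_inf: "g u = \<infinity>" if "u \<notin> Z" for u
    using that closed_convex_on_infinite[of u] \<alpha> by (simp add: g)
  have "g y0 \<le> g u" for u
    by (cases "u \<in> Z") (use min0 gG y0Z g_inf in auto)
  then have "is_arg_min g (\<lambda>_. True) y0"
    unfolding is_arg_min_def by (simp add: not_less)
  then have am: "is_arg_min g (\<lambda>_. True) (argmin g)"
    unfolding argmin_def arg_min_def by (rule someI)
  show Zy: "argmin g \<in> Z"
    using am gG[OF y0Z] g_inf[of "argmin g"] unfolding is_arg_min_def by force
  let ?y = "argmin g"
  have min: "G ?y \<le> G u" if "u \<in> Z" for u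
    using am gG[OF Zy] gG[OF that] unfolding is_arg_min_def by (metis ereal_less_eq(3) not_le)
  show "G ?y + \<beta> / 2 * (norm (u - ?y))\<^sup>2 \<le> G u" if u: "u \<in> Z"
  proof -
    \<comment> \<open>Minimality against a point of the segment gives the bound with an extra factor
      1 - t. Since t may be arbitrarily small, the bound holds with every factor s < 1, hence
      without it.\<close>
    have "\<beta> / 2 * (norm (u - ?y))\<^sup>2 \<le> G u - G ?y"
    proof (rule field_le_mult_one_interval)
      fix s :: real assume s: "0 < s" "s < 1"
      define t where "t = 1 - s"
      have t: "0 < t" "t < 1" using s by (auto simp: t_def)
      let ?u = "(1 - t) *\<^sub>R ?y + t *\<^sub>R u"
      have eq: "?u - w = (1 - t) *\<^sub>R (?y - w) + t *\<^sub>R (u - w)" by (simp add: algebra_simps)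
      have "(norm ((1 - t) *\<^sub>R x + t *\<^sub>R z))\<^sup>2
          = (1 - t) * (norm x)\<^sup>2 + t * (norm z)\<^sup>2 - t * (1 - t) * (norm (z - x))\<^sup>2" for x z :: 'a
        by (simp add: power2_norm_eq_inner inner_add_left inner_add_right inner_diff_left
            inner_diff_right inner_commute[of z x] algebra_simps)
      from this[of "?y - w" "u - w"]
      have sq: "(norm (?u - w))\<^sup>2
          = (1 - t) * (norm (?y - w))\<^sup>2 + t * (norm (u - w))\<^sup>2 - t * (1 - t) * (norm (u - ?y))\<^sup>2"
        unfolding eq by simp
      have inn: "v \<bullet> (?u - w) = (1 - t) * (v \<bullet> (?y - w)) + t * (v \<bullet> (u - w))"
        unfolding eq by (simp add: inner_add_right)
      have p_eq: "p ?u = (1 - t) * p ?y + t * p u - t * ((1 - t) * (\<beta> / 2 * (norm (u - ?y))\<^sup>2))"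
        unfolding p_def inn sq by (simp add: field_simps)
      have "\<alpha> * real_part h ?u \<le> \<alpha> * ((1 - t) * real_part h ?y + t * real_part h u)"
        using closed_convex_on_segment(2)[OF Zy u t] \<alpha> by (intro mult_left_mono) auto
      then have "G ?u \<le> (1 - t) * G ?y + t * G u - t * ((1 - t) * (\<beta> / 2 * (norm (u - ?y))\<^sup>2))"
        unfolding Gp p_eq by (simp add: algebra_simps)
      moreover have "G ?y \<le> G ?u" using min closed_convex_on_segment(1)[OF Zy u t] by blast
      ultimately have "t * ((1 - t) * (\<beta> / 2 * (norm (u - ?y))\<^sup>2)) \<le> t * (G u - G ?y)"
        by (simp add: algebra_simps)
      then show "s * (\<beta> / 2 * (norm (u - ?y))\<^sup>2) \<le> G u - G ?y"
        using t by (simp add: t_def)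
    qed
    then show ?thesis by simp
  qed
qed

end

section \<open>Distance to a convex set\<close>

lemma inner_closest_point_nonpos:
  assumes "convex S" "closed S" "S \<noteq> {}"
  shows "(x - closest_point S x) \<bullet> (closest_point S y - closest_point S x) \<le> 0"
  using assms closest_point_dot[of S "closest_point S y" x] closest_point_in_set by blast

context
  fixes S :: "'b::euclidean_space set"
  assumes S: "closed S" "convex S" "S \<noteq> {}"
begin

lemma infdist_closest_point: "infdist x S = norm (x - closest_point S x)"
  using setdist_closest_point[OF S(1,3)] by (simp add: infdist_eq_setdist dist_norm)

text \<open>The projection of \<open>w\<close> is a candidate in the distance from \<open>v\<close>.
  With the lower bound below, half the squared distance is convex and 1-smooth with gradient
  \<open>w - closest_point S w\<close>.\<close>

lemma half_infdist_sq_upper: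
  "(infdist v S)\<^sup>2 / 2 \<le> (infdist w S)\<^sup>2 / 2 + (w - closest_point S w) \<bullet> (v - w) + (norm (v - w))\<^sup>2 / 2"
proof -
  have "infdist v S \<le> dist v (closest_point S w)"
    by (rule infdist_le) (rule closest_point_in_set[OF S(1,3)])
  then have "(infdist v S)\<^sup>2 \<le> (norm ((v - w) + (w - closest_point S w)))\<^sup>2"
    by (intro power_mono infdist_nonneg) (simp add: dist_norm)
  then show ?thesis unfolding norm_add_sq infdist_closest_point[of w] by (simp add: inner_commute)
qed

lemma half_infdist_sq_lower:
  "(infdist v S)\<^sup>2 / 2 \<ge> (infdist w S)\<^sup>2 / 2 + (w - closest_point S w) \<bullet> (v - w)"
proof -
  let ?a = "w - closest_point S w" and ?b = "v - closest_point S v"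
  let ?d = "closest_point S v - closest_point S w"
  have "?a \<bullet> ?d \<le> 0" using inner_closest_point_nonpos[OF S(2,1,3)] .
  moreover have "?a \<bullet> (v - w) = ?a \<bullet> ?b - (norm ?a)\<^sup>2 + ?a \<bullet> ?d"
    by (simp add: inner_diff_right inner_diff_left power2_norm_eq_inner inner_commute)
  moreover have "(norm (?b - ?a))\<^sup>2 \<ge> 0" by simp
  ultimately show ?thesis
    unfolding infdist_closest_point norm_diff_sq[of ?b ?a] by (simp add: inner_commute)
qed

text \<open>By the obtuse angle inequality at both projections, the increments of residual and
  projection have nonnegative inner product; they add up to \<open>v - w\<close>, so neither is
  longer than it.\<close>

lemma closest_point_residual_nonexpansive:
  "norm ((v - closest_point S v) - (w - closest_point S w)) \<le> norm (v - w)"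
proof -
  let ?a = "w - closest_point S w" and ?b = "v - closest_point S v"
  let ?d = "closest_point S v - closest_point S w"
  have "?a \<bullet> ?d \<le> 0" using inner_closest_point_nonpos[OF S(2,1,3)] .
  moreover have "?b \<bullet> (- ?d) \<le> 0" using inner_closest_point_nonpos[OF S(2,1,3), of v w] by simp
  ultimately have "0 \<le> (?b - ?a) \<bullet> ?d"
    using inner_diff_left[of ?b ?a ?d] inner_minus_right[of ?b ?d] by linarith
  moreover have "(norm (v - w))\<^sup>2 = (norm (?b - ?a))\<^sup>2 + 2 * ((?b - ?a) \<bullet> ?d) + (norm ?d)\<^sup>2"
    using norm_add_sq[of "?b - ?a" ?d] by (simp add: algebra_simps)
  ultimately have "(norm (?b - ?a))\<^sup>2 \<le> (norm (v - w))\<^sup>2"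
    using zero_le_power2[of "norm ?d"] by linarith
  then show ?thesis using power2_le_imp_le norm_ge_zero by blast
qed

lemma GDERIV_half_infdist_sq:
  fixes A :: "'a::euclidean_space \<Rightarrow> 'b"
  assumes "linear A"
  shows "GDERIV (\<lambda>u. c / 2 * (infdist (A u) S)\<^sup>2) x :> c *\<^sub>R adjoint A (A x - closest_point S (A x))"
proof -
  let ?g = "\<lambda>v. (infdist v S)\<^sup>2 / 2"
  have "(?g has_derivative (\<lambda>d. (w - closest_point S w) \<bullet> d)) (at w)" for w
  proof (rule has_derivativeI)
    show "bounded_linear (\<lambda>d. (w - closest_point S w) \<bullet> d)" by (rule bounded_linear_inner_right)
    \<comment> \<open>The first-order remainder lies between 0 and half the squared
      increment.\<close>
    have bnd: "norm ((?g v - ?g w - (w - closest_point S w) \<bullet> (v - w)) /\<^sub>R norm (v - w))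
      \<le> norm (v - w) / 2" for v
    proof (cases "v = w")
      case False
      have "\<bar>?g v - ?g w - (w - closest_point S w) \<bullet> (v - w)\<bar> \<le> (norm (v - w))\<^sup>2 / 2"
        using half_infdist_sq_upper[of v w] half_infdist_sq_lower[of w v] by (simp add: abs_le_iff)
      then show ?thesis using False by (simp add: field_simps power2_eq_square)
    qed simp
    have "((\<lambda>v. norm (v - w) / 2) \<longlongrightarrow> 0) (at w)"
      by (auto intro!: tendsto_eq_intros)
    then show "((\<lambda>v. (?g v - ?g w - (w - closest_point S w) \<bullet> (v - w)) /\<^sub>R norm (v - w)) \<longlongrightarrow> 0) (at w)"
      by (rule Lim_null_comparison[rotated]) (intro always_eventually allI bnd)
  qed
  moreover have "(A has_derivative A) (at x)"
    using assms by (simp add: bounded_linear_imp_has_derivative linear_conv_bounded_linear)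
  ultimately have "((\<lambda>u. ?g (A u)) has_derivative (\<lambda>d. (A x - closest_point S (A x)) \<bullet> A d)) (at x)"
    using has_derivative_compose[of A A x UNIV ?g] by simp
  from has_derivative_mult_right[OF this, of c]
  show ?thesis unfolding gderiv_def
    by (simp add: adjoint_works[OF assms] inner_commute)
qed

end

section \<open>Gradients as representatives of derivatives\<close>

lemma GDERIV_unique: "GDERIV f z :> D \<Longrightarrow> GDERIV f z :> E \<Longrightarrow> D = E"
proof -
  assume "GDERIV f z :> D" "GDERIV f z :> E"
  then have *: "(\<lambda>d. d \<bullet> D) = (\<lambda>d. d \<bullet> E)"
    unfolding gderiv_def by (rule has_derivative_unique)
  have "d \<bullet> D = d \<bullet> E" for d using fun_cong[OF *, of d] .
  then have "(D - E) \<bullet> (D - E) = 0" by (simp add: inner_diff_right)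
  then show "D = E" by simp
qed

lemma grad_eq: "GDERIV f z :> D \<Longrightarrow> grad f z = D"
  unfolding grad_def using GDERIV_unique by blast

lemma differentiable_GDERIV_grad:
  fixes f :: "'a::euclidean_space \<Rightarrow> real"
  assumes "f differentiable (at z)"
  shows "GDERIV f z :> grad f z"
proof -
  obtain f' where f': "(f has_derivative f') (at z)" using assms differentiable_def by blast
  define D where "D = adjoint f' 1"
  have "f' x = x \<bullet> D" for x
    using adjoint_works[OF has_derivative_linear[OF f'], of x 1] by (simp add: D_def)
  then have "f' = (\<lambda>x. x \<bullet> D)" by (rule ext)
  then have "GDERIV f z :> D" using f' unfolding gderiv_def by simp
  then show ?thesis using grad_eq[of f z D] by simp
qed

section \<open>The accelerated gradient iteration\<close>

lemma norm_sq_shift: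
  fixes u w z :: "'a::real_inner"
  shows "(norm (u - w))\<^sup>2 = (norm (z - w))\<^sup>2 + 2 * ((z - w) \<bullet> (u - z)) + (norm (u - z))\<^sup>2"
  using norm_add_sq[of "z - w" "u - z"] by simp

text \<open>Completing the square: \<open>x'\<close> minimizes the left-hand side, whose Hessian is \<open>\<kappa> + \<mu> * a\<close>.\<close>

lemma quadratic_recentre:
  fixes x x' y' xt u :: "'a::real_inner"
  assumes x': "x' = x + (a / (\<kappa> + \<mu> * a)) *\<^sub>R (L *\<^sub>R (y' - xt) + \<mu> *\<^sub>R (y' - x))"
    and pos: "\<kappa> + \<mu> * a \<noteq> 0"
    and \<gamma>: "\<And>u. \<gamma> u = qv + L * ((xt - y') \<bullet> (u - y')) + \<mu> / 2 * (norm (u - y'))\<^sup>2"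
  shows "\<kappa> / 2 * (norm (u - x))\<^sup>2 + a * \<gamma> u
    = \<kappa> / 2 * (norm (x' - x))\<^sup>2 + a * \<gamma> x' + (\<kappa> + \<mu> * a) / 2 * (norm (u - x'))\<^sup>2"
proof -
  have "(\<kappa> + \<mu> * a) *\<^sub>R (x' - x) = a *\<^sub>R (L *\<^sub>R (y' - xt) + \<mu> *\<^sub>R (y' - x))"
    using pos by (simp add: x')
  then have "\<kappa> *\<^sub>R (x' - x) + (a * L) *\<^sub>R (xt - y') + (a * \<mu>) *\<^sub>R (x' - y') = 0"
    by (simp add: algebra_simps)
  then have "(\<kappa> *\<^sub>R (x' - x) + (a * L) *\<^sub>R (xt - y') + (a * \<mu>) *\<^sub>R (x' - y')) \<bullet> (u - x') = 0"
    by simp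
  then have st: "\<kappa> * ((x' - x) \<bullet> (u - x')) + a * L * ((xt - y') \<bullet> (u - x'))
      + a * \<mu> * ((x' - y') \<bullet> (u - x')) = 0"
    by (simp add: inner_add_left)
  have lin: "(xt - y') \<bullet> (u - y') = (xt - y') \<bullet> (u - x') + (xt - y') \<bullet> (x' - y')"
    by (simp add: inner_diff_right)
  show ?thesis
    unfolding \<gamma> norm_sq_shift[of u x x'] norm_sq_shift[of u y' x'] lin
    using st by (simp add: algebra_simps add_divide_distrib)
qed

text \<open>This is where the step size rule comes from. By the choice of \<open>xt\<close>, the
  linear parts of \<open>\<gamma>\<close> at \<open>y\<close> and \<open>u\<close> combine into a
  multiple of \<open>xt - y'\<close> plus a cross term with \<open>u - x\<close>, and the equation
  for \<open>a\<close> is the one under which that cross term completes a perfect square.\<close>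

lemma estimate_step_lower:
  fixes x y y' xt u :: "'a::real_inner"
  assumes A: "A \<ge> 0" and a: "a > 0" and \<mu>: "\<mu> \<ge> 0" and \<kappa>: "\<kappa> > 0"
    and a_eq: "L * a\<^sup>2 = \<kappa> * (A + a)"
    and xt: "(A + a) *\<^sub>R xt = A *\<^sub>R y + a *\<^sub>R x"
    and \<gamma>: "\<And>u. \<gamma> u = qv + L * ((xt - y') \<bullet> (u - y')) + \<mu> / 2 * (norm (u - y'))\<^sup>2"
  shows "A * \<gamma> y + (\<kappa> / 2 * (norm (u - x))\<^sup>2 + a * \<gamma> u)
    \<ge> (A + a) * (qv + L / 2 * (norm (y' - xt))\<^sup>2)"
proof -
  let ?e = "xt - y'" and ?d = "u - x"
  have low: "\<gamma> w \<ge> qv + L * (?e \<bullet> (w - y'))" for w unfolding \<gamma> using \<mu> by simp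
  have "A *\<^sub>R (y - y') + a *\<^sub>R (u - y') = (A + a) *\<^sub>R ?e + a *\<^sub>R ?d"
    using xt by (simp add: algebra_simps)
  then have "?e \<bullet> (A *\<^sub>R (y - y') + a *\<^sub>R (u - y')) = ?e \<bullet> ((A + a) *\<^sub>R ?e + a *\<^sub>R ?d)" by simp
  then have e: "A * (?e \<bullet> (y - y')) + a * (?e \<bullet> (u - y')) = (A + a) * (norm ?e)\<^sup>2 + a * (?e \<bullet> ?d)"
    unfolding inner_add_right inner_scaleR_right power2_norm_eq_inner .
  have "(A + a) * qv + L * (A * (?e \<bullet> (y - y')) + a * (?e \<bullet> (u - y'))) \<le> A * \<gamma> y + a * \<gamma> u"
    using mult_left_mono[OF low[of y] A] mult_left_mono[OF low[of u], of a] a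
    by (simp add: algebra_simps)
  then have 1: "(A + a) * qv + L * ((A + a) * (norm ?e)\<^sup>2 + a * (?e \<bullet> ?d)) \<le> A * \<gamma> y + a * \<gamma> u"
    unfolding e .
  have "0 \<le> (norm (\<kappa> *\<^sub>R ?d + (L * a) *\<^sub>R ?e))\<^sup>2" by simp
  also have "\<dots> = \<kappa>\<^sup>2 * (norm ?d)\<^sup>2 + 2 * \<kappa> * L * a * (?e \<bullet> ?d) + L * (L * a\<^sup>2) * (norm ?e)\<^sup>2"
    unfolding norm_add_sq norm_scaleR power_mult_distrib power2_abs
    by (simp add: inner_commute[of ?d] power2_eq_square)
  also have "\<dots> = \<kappa> * (\<kappa> * (norm ?d)\<^sup>2 + 2 * L * a * (?e \<bullet> ?d) + L * (A + a) * (norm ?e)\<^sup>2)"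
    unfolding a_eq by (simp add: power2_eq_square algebra_simps)
  finally have "0 \<le> \<kappa> * (norm ?d)\<^sup>2 + 2 * L * a * (?e \<bullet> ?d) + L * (A + a) * (norm ?e)\<^sup>2"
    using \<kappa> by (simp add: zero_le_mult_iff)
  with 1 show ?thesis by (simp add: norm_minus_commute[of y' xt] algebra_simps add_divide_distrib)
qed

lemma first_from_exists:
  assumes "k0 \<le> j" "P j"
  shows "\<exists>k\<le>j. first_from k0 P k"
proof -
  let ?Q = "\<lambda>k. k0 \<le> k \<and> P k"
  have "?Q (LEAST k. ?Q k)" using assms by (intro LeastI[of ?Q j]) auto
  moreover have "(LEAST k. ?Q k) \<le> j" using assms by (intro Least_le) auto
  moreover have "\<not> ?Q i" if "i < (LEAST k. ?Q k)" for i using not_less_Least[OF that] .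
  ultimately show ?thesis unfolding first_from_def by blast
qed

text \<open>The model inequalities are asked only at the extrapolated points, which may lie outside
  \<open>Z\<close>; the lower one acts as strong convexity with modulus \<mu>, the upper one as
  smoothness.\<close>

locale accelerated_gradient =
  fixes Z :: "'a::euclidean_space set" and \<psi>s :: "'a \<Rightarrow> real" and \<psi>n :: "'a \<Rightarrow> ereal"
    and y0 :: 'a and \<mu> L :: real
  assumes closed_convex: "closed_convex_on Z \<psi>n" and start: "y0 \<in> Z"
    and \<mu>: "0 < \<mu>" "\<mu> \<le> 1" and L: "1 \<le> L"
    and model_lower: "\<And>k u xt. u \<in> Z \<Longrightarrow> xt = acg_xt \<mu> L (acg \<psi>s \<psi>n y0 \<mu> L k) \<Longrightarrow>
      linearization \<psi>s xt u + \<mu> / 2 * (norm (u - xt))\<^sup>2 \<le> \<psi>s u"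
    and model_upper: "\<And>k u xt. u \<in> Z \<Longrightarrow> xt = acg_xt \<mu> L (acg \<psi>s \<psi>n y0 \<mu> L k) \<Longrightarrow>
      \<psi>s u \<le> linearization \<psi>s xt u + L / 2 * (norm (u - xt))\<^sup>2"
begin

abbreviation "state \<equiv> acg \<psi>s \<psi>n y0 \<mu> L"
abbreviation "A k \<equiv> st_A (state k)"
abbreviation "y k \<equiv> st_y (state k)"
abbreviation "x k \<equiv> st_x (state k)"
abbreviation "\<Gamma> k \<equiv> st_\<Gamma> (state k)"
abbreviation "a k \<equiv> acg_a \<mu> L (state k)"
abbreviation "xt k \<equiv> acg_xt \<mu> L (state k)"
abbreviation "r k \<equiv> acg_r y0 (state k)"
abbreviation "err k \<equiv> acg_eta \<psi>s \<psi>n y0 (state k)"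
abbreviation "residual k \<equiv> norm (y0 - y k + r k)"

definition \<psi> :: "'a \<Rightarrow> real" where
  "\<psi> u = \<psi>s u + real_part \<psi>n u"

definition q :: "nat \<Rightarrow> 'a \<Rightarrow> real" where
  "q k u = linearization \<psi>s (xt k) u + real_part \<psi>n u + \<mu> / 2 * (norm (u - xt k))\<^sup>2"

text \<open>\<open>a k\<close> is the positive root of a^2 = \<tau> (A + a). Dropping \<tau>^2 under
  its square root gives a \<ge> \<tau>/2 + sqrt (\<tau> A), which is an additive increment for sqrt
  A.\<close>

lemma step_size:
  assumes "A k \<ge> 0"
  shows "a k > 0" and "L * (a k)\<^sup>2 = (1 + \<mu> * A k) * (A k + a k)"
    and "(sqrt (A k) + sqrt ((1 + \<mu> * A k) / L) / 2)\<^sup>2 \<le> A k + a k"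
proof -
  define \<tau> where "\<tau> = (1 + \<mu> * A k) / L"
  have \<tau>: "\<tau> > 0" using assms \<mu> L by (simp add: \<tau>_def add_pos_nonneg)
  have a: "a k = (\<tau> + sqrt (\<tau>\<^sup>2 + 4 * \<tau> * A k)) / 2"
    by (simp add: acg_a_def \<tau>_def Let_def)
  have nn: "\<tau>\<^sup>2 + 4 * \<tau> * A k \<ge> 0" using \<tau> assms by simp
  show "a k > 0" unfolding a using \<tau> nn by (simp add: add_pos_nonneg)
  have "2 * a k - \<tau> = sqrt (\<tau>\<^sup>2 + 4 * \<tau> * A k)" unfolding a by (simp add: add_divide_distrib)
  then have "(2 * a k - \<tau>)\<^sup>2 = \<tau>\<^sup>2 + 4 * \<tau> * A k" using nn by simp
  then have "(a k)\<^sup>2 = \<tau> * (A k + a k)" by (simp add: power2_eq_square algebra_simps)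
  then have "L * (a k)\<^sup>2 = (L * \<tau>) * (A k + a k)" by simp
  then show "L * (a k)\<^sup>2 = (1 + \<mu> * A k) * (A k + a k)" using L by (simp add: \<tau>_def)
  have "sqrt (4 * \<tau> * A k) \<le> sqrt (\<tau>\<^sup>2 + 4 * \<tau> * A k)" using \<tau> by simp
  then have "sqrt \<tau> * sqrt (A k) \<le> sqrt (\<tau>\<^sup>2 + 4 * \<tau> * A k) / 2"
    by (simp add: real_sqrt_mult)
  moreover have "(sqrt (A k) + sqrt \<tau> / 2)\<^sup>2 = A k + sqrt \<tau> * sqrt (A k) + \<tau> / 4"
    using \<tau> assms by (simp add: power2_sum power_divide)
  ultimately show "(sqrt (A k) + sqrt ((1 + \<mu> * A k) / L) / 2)\<^sup>2 \<le> A k + a k"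
    unfolding a \<tau>_def[symmetric] using \<tau> by simp
qed

text \<open>The three-point inequality of the prox step, multiplied by \<open>L\<close> and
  recentred at the new iterate. It says that the quadratic added to the estimate sequence minorizes
  \<open>q k\<close> on \<open>Z\<close> and touches it at the new iterate.\<close>

lemma step_y:
  shows "y (Suc k) \<in> Z"
    and "u \<in> Z \<Longrightarrow> q k (y (Suc k)) + L * ((xt k - y (Suc k)) \<bullet> (u - y (Suc k)))
      + \<mu> / 2 * (norm (u - y (Suc k)))\<^sup>2 \<le> q k u"
proof -
  define g where "g = (\<lambda>u. ereal (1 / L) * acg_q \<psi>s \<psi>n \<mu> (xt k) u + ereal ((norm (u - xt k))\<^sup>2 / 2))"
  define G where "G = (\<lambda>u. 1 / L * q k u + (norm (u - xt k))\<^sup>2 / 2)"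
  have y: "y (Suc k) = argmin g"
    by (simp add: acg_step_def Let_def g_def)
  let ?c = "\<psi>s (xt k) / L" and ?v = "(1 / L) *\<^sub>R grad \<psi>s (xt k)"
  have g: "g u = ereal (1 / L) * \<psi>n u
      + ereal (?c + ?v \<bullet> (u - xt k) + (\<mu> / L + 1) / 2 * (norm (u - xt k))\<^sup>2)" for u
  proof -
    have "\<psi>n u \<noteq> - \<infinity>" using closed_convex by (simp add: closed_convex_on_def)
    then show ?thesis using L
      by (cases "\<psi>n u") (auto simp: g_def acg_q_def linearization_def field_simps)
  qed
  have G: "G u = 1 / L * real_part \<psi>n u
      + (?c + ?v \<bullet> (u - xt k) + (\<mu> / L + 1) / 2 * (norm (u - xt k))\<^sup>2)" for u
    using L by (simp add: G_def q_def linearization_def field_simps)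
  have pos: "1 / L > 0" "\<mu> / L + 1 > 0" using \<mu> L by (auto intro: add_pos_pos)
  show "y (Suc k) \<in> Z"
    unfolding y by (rule prox_argmin(1)[OF closed_convex pos g G])
  assume u: "u \<in> Z"
  define y' where "y' = y (Suc k)"
  have "G y' + (\<mu> / L + 1) / 2 * (norm (u - y'))\<^sup>2 \<le> G u"
    unfolding y'_def y by (rule prox_argmin(2)[OF closed_convex pos g G u])
  then have "L * (G y' + (\<mu> / L + 1) / 2 * (norm (u - y'))\<^sup>2) \<le> L * G u"
    using L by (intro mult_left_mono) auto
  moreover have LG: "L * G w = q k w + L / 2 * (norm (w - xt k))\<^sup>2" for w
    using L by (simp add: G_def field_simps)
  moreover have "L * ((\<mu> / L + 1) / 2 * (norm (u - y'))\<^sup>2) = (\<mu> + L) / 2 * (norm (u - y'))\<^sup>2"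
    using L by (simp add: field_simps)
  ultimately have "q k y' + L / 2 * (norm (y' - xt k))\<^sup>2 + (\<mu> + L) / 2 * (norm (u - y'))\<^sup>2
      \<le> q k u + L / 2 * (norm (u - xt k))\<^sup>2"
    by (simp only: distrib_left)
  moreover have "(xt k - y') \<bullet> (u - y') = - ((y' - xt k) \<bullet> (u - y'))"
    by (simp add: inner_diff_left)
  ultimately have "q k y' + L * ((xt k - y') \<bullet> (u - y')) + \<mu> / 2 * (norm (u - y'))\<^sup>2 \<le> q k u"
    unfolding norm_sq_shift[of u "xt k" y'] by (simp add: algebra_simps add_divide_distrib)
  then show "q k (y (Suc k)) + L * ((xt k - y (Suc k)) \<bullet> (u - y (Suc k)))
      + \<mu> / 2 * (norm (u - y (Suc k)))\<^sup>2 \<le> q k u"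
    unfolding y'_def .
qed

lemma y_in: "y k \<in> Z"
  using start step_y(1) by (cases k) auto

text \<open>Multiplication by \<open>A k\<close> makes the start trivial, as \<open>A 0 = 0\<close>.
  \<open>C\<close> is the minimum of the quadratic, whose curvature \<open>1 + \<mu> * A k\<close>
  is the one in the step size rule.\<close>

lemma invariant:
  "A k \<ge> 0 \<and>
   (\<forall>u\<in>Z. A k * \<Gamma> k u \<le> A k * \<psi> u) \<and>
   (\<exists>C. C \<ge> A k * \<psi> (y k) \<and>
     (\<forall>u. A k * \<Gamma> k u + (norm (u - y0))\<^sup>2 / 2 = C + (1 + \<mu> * A k) / 2 * (norm (u - x k))\<^sup>2))"
proof (induction k)
  case 0
  then show ?case by (auto intro!: exI[of _ 0])
next
  case (Suc k)
  let ?A' = "A k + a k" and ?y' = "y (Suc k)" and ?x' = "x (Suc k)" and ?\<kappa> = "1 + \<mu> * A k"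
  from Suc obtain C where A0: "A k \<ge> 0" and \<Gamma>: "\<And>u. u \<in> Z \<Longrightarrow> A k * \<Gamma> k u \<le> A k * \<psi> u"
    and C: "C \<ge> A k * \<psi> (y k)"
    and eq: "\<And>u. A k * \<Gamma> k u + (norm (u - y0))\<^sup>2 / 2 = C + ?\<kappa> / 2 * (norm (u - x k))\<^sup>2" by blast
  note a = step_size[OF A0]
  have A': "A (Suc k) = ?A'" "?A' > 0" using a A0 by (simp_all add: acg_step_def Let_def)
  have \<kappa>: "?\<kappa> > 0" using \<mu> A0 by (simp add: add_pos_nonneg)
  have \<kappa>': "?\<kappa> + \<mu> * a k = 1 + \<mu> * ?A'" by (simp add: algebra_simps)
  define \<gamma> where "\<gamma> u = q k ?y' + L * ((xt k - ?y') \<bullet> (u - ?y')) + \<mu> / 2 * (norm (u - ?y'))\<^sup>2" for u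
  have x': "?x' = x k + (a k / (?\<kappa> + \<mu> * a k)) *\<^sub>R (L *\<^sub>R (?y' - xt k) + \<mu> *\<^sub>R (?y' - x k))"
    unfolding \<kappa>' by (simp add: acg_step_def Let_def)
  have "real_of_ereal (acg_q \<psi>s \<psi>n \<mu> (xt k) ?y') = q k ?y'"
    unfolding acg_q_def q_def closed_convex_on_finite[OF closed_convex step_y(1)] by simp
  then have \<Gamma>': "\<Gamma> (Suc k) u = A k / ?A' * \<Gamma> k u + a k / ?A' * \<gamma> u" for u
    by (simp add: acg_step_def Let_def \<gamma>_def)
  have \<Gamma>'': "?A' * \<Gamma> (Suc k) u = A k * \<Gamma> k u + a k * \<gamma> u" for u
    unfolding \<Gamma>' using A'(2) by (simp add: distrib_left)
  have q_le: "q k u \<le> \<psi> u" if "u \<in> Z" for u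
    using model_lower[OF that, of _ k] by (simp add: q_def \<psi>_def)
  have \<gamma>_le: "\<gamma> u \<le> \<psi> u" if "u \<in> Z" for u
    using step_y(2)[OF that, of k] q_le[OF that] by (simp add: \<gamma>_def)
  have xt: "?A' *\<^sub>R xt k = A k *\<^sub>R y k + a k *\<^sub>R x k"
    using A'(2) by (simp add: acg_xt_def Let_def scaleR_add_right)
  define C' where "C' = C + (?\<kappa> / 2 * (norm (?x' - x k))\<^sup>2 + a k * \<gamma> ?x')"
  have eq': "A (Suc k) * \<Gamma> (Suc k) u + (norm (u - y0))\<^sup>2 / 2
      = C' + (1 + \<mu> * A (Suc k)) / 2 * (norm (u - ?x'))\<^sup>2" for u
    using eq[of u] quadratic_recentre[OF x' _ \<gamma>_def, of u] \<kappa> \<mu> a(1)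
    unfolding A'(1) \<Gamma>'' \<kappa>'[symmetric] C'_def by (simp add: add_pos_pos less_imp_neq[symmetric])
  have "\<psi> ?y' \<le> q k ?y' + L / 2 * (norm (?y' - xt k))\<^sup>2"
  proof -
    have "0 \<le> \<mu> / 2 * (norm (?y' - xt k))\<^sup>2" using \<mu> by simp
    then show ?thesis using model_upper[OF step_y(1) refl, of k k] unfolding q_def \<psi>_def by linarith
  qed
  then have "?A' * \<psi> ?y' \<le> ?A' * (q k ?y' + L / 2 * (norm (?y' - xt k))\<^sup>2)"
    using A'(2) by (intro mult_left_mono) auto
  also have "\<dots> \<le> A k * \<gamma> (y k) + (?\<kappa> / 2 * (norm (?x' - x k))\<^sup>2 + a k * \<gamma> ?x')"
    using estimate_step_lower[OF A0 a(1) _ \<kappa> a(2) xt \<gamma>_def] \<mu> by simp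
  also have "\<dots> \<le> C'"
    using mult_left_mono[OF \<gamma>_le[OF y_in[of k]] A0] C unfolding C'_def by linarith
  finally have C': "C' \<ge> A (Suc k) * \<psi> ?y'" unfolding A'(1) .
  have "A (Suc k) * \<Gamma> (Suc k) u \<le> A (Suc k) * \<psi> u" if "u \<in> Z" for u
  proof -
    have "a k * \<gamma> u \<le> a k * \<psi> u" using \<gamma>_le[OF that] a(1) by (intro mult_left_mono) auto
    then have "A k * \<Gamma> k u + a k * \<gamma> u \<le> ?A' * \<psi> u"
      using \<Gamma>[OF that] unfolding distrib_right by linarith
    then show ?thesis unfolding A'(1) \<Gamma>'' .
  qed
  with A' eq' C' show ?case by (metis less_imp_le)
qed

section \<open>Consequences of the estimate sequence\<close>

lemma A_nonneg: "A k \<ge> 0"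
  using invariant by blast

lemma A_step: "A (Suc k) = A k + a k"
  by (simp add: acg_step_def Let_def)

lemma A_mono: "k \<le> j \<Longrightarrow> A k \<le> A j"
  by (rule lift_Suc_mono_le[of A]) (use step_size(1)[OF A_nonneg] A_step in \<open>auto simp: less_imp_le\<close>)

lemma sqrt_A_step: "sqrt (A k) + sqrt ((1 + \<mu> * A k) / L) / 2 \<le> sqrt (A (Suc k))"
  using step_size(3)[OF A_nonneg, of k] A_step real_le_rsqrt by metis

lemma A_pos: "1 \<le> k \<Longrightarrow> A k > 0"
  using step_size(1)[OF A_nonneg] A_step A_nonneg by (cases k) (auto simp: add_nonneg_pos simp del: acg.simps)

lemma scaled_r: "1 \<le> k \<Longrightarrow> A k *\<^sub>R r k = y0 - x k"
  using A_pos[of k] by (simp add: acg_r_def)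

lemma err_eq: "err k = \<psi> (y k) - \<Gamma> k (x k) - r k \<bullet> (y k - x k)"
  unfolding acg_eta_def \<psi>_def using closed_convex_on_finite[OF closed_convex y_in[of k]] by simp

lemma descent:
  assumes "u \<in> Z"
  shows "A k * \<psi> (y k) + (1 + \<mu> * A k) / 2 * (norm (u - x k))\<^sup>2 \<le> A k * \<psi> u + (norm (u - y0))\<^sup>2 / 2"
proof -
  from invariant[of k] obtain C where "A k * \<psi> (y k) \<le> C"
    and "A k * \<Gamma> k u + (norm (u - y0))\<^sup>2 / 2 = C + (1 + \<mu> * A k) / 2 * (norm (u - x k))\<^sup>2" by blast
  moreover have "A k * \<Gamma> k u \<le> A k * \<psi> u" using invariant assms by blast
  ultimately show ?thesis by linarith
qed

text \<open>As the quadratic is centred at \<open>x k\<close>, the gradient of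
  \<open>\<Gamma> k\<close> there is \<open>r k\<close>; \<open>err k\<close> accounts for moving
  the base point from \<open>x k\<close> to \<open>y k\<close>.\<close>

lemma approximate_subgradient:
  assumes k: "1 \<le> k" and u: "u \<in> Z"
  shows "\<psi> (y k) + r k \<bullet> (u - y k) - err k \<le> \<psi> u"
proof -
  from invariant[of k] obtain C where
    C: "\<And>u. A k * \<Gamma> k u + (norm (u - y0))\<^sup>2 / 2 = C + (1 + \<mu> * A k) / 2 * (norm (u - x k))\<^sup>2" by blast
  have "(norm (u - y0))\<^sup>2 = (norm (x k - y0))\<^sup>2 - 2 * ((A k *\<^sub>R r k) \<bullet> (u - x k)) + (norm (u - x k))\<^sup>2"
    unfolding norm_sq_shift[of u y0 "x k"] scaled_r[OF k] by (simp add: inner_diff_left)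
  moreover have "0 \<le> \<mu> * A k * (norm (u - x k))\<^sup>2" using \<mu> A_nonneg by simp
  ultimately have "A k * \<Gamma> k u \<ge> A k * \<Gamma> k (x k) + A k * (r k \<bullet> (u - x k))"
    using C[of u] C[of "x k"] by (simp add: algebra_simps add_divide_distrib)
  moreover have "A k * \<Gamma> k u \<le> A k * \<psi> u" using invariant u by blast
  ultimately have "A k * (\<Gamma> k (x k) + r k \<bullet> (u - x k)) \<le> A k * \<psi> u"
    by (simp add: distrib_left)
  then have "\<Gamma> k (x k) + r k \<bullet> (u - x k) \<le> \<psi> u" using A_pos[OF k] by simp
  then show ?thesis unfolding err_eq by (simp add: inner_diff_right)
qed

lemma err_nonneg: "1 \<le> k \<Longrightarrow> err k \<ge> 0"
  using approximate_subgradient[OF _ y_in[of k], of k] by simp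

lemma err_bound:
  assumes k: "1 \<le> k"
  shows "2 * A k * err k + (norm (y k - x k))\<^sup>2 \<le> (norm (y k - y0))\<^sup>2"
proof -
  from invariant[of k] obtain C where C: "A k * \<psi> (y k) \<le> C"
    "\<And>u. A k * \<Gamma> k u + (norm (u - y0))\<^sup>2 / 2 = C + (1 + \<mu> * A k) / 2 * (norm (u - x k))\<^sup>2" by blast
  have "(norm (y k - y0))\<^sup>2 = (norm (x k - y0))\<^sup>2 - 2 * ((A k *\<^sub>R r k) \<bullet> (y k - x k)) + (norm (y k - x k))\<^sup>2"
    unfolding norm_sq_shift[of "y k" y0 "x k"] scaled_r[OF k] by (simp add: inner_diff_left)
  then show ?thesis unfolding err_eq using C(1) C(2)[of "x k"] by (simp add: algebra_simps)
qed

lemma distance_bounds: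
  assumes k: "1 \<le> k"
  shows "norm (y k - x k) \<le> norm (y k - y0)" and "err k \<le> (norm (y k - y0))\<^sup>2 / (2 * A k)"
proof -
  have "0 \<le> 2 * A k * err k" using err_nonneg[OF k] A_nonneg by simp
  then have "(norm (y k - x k))\<^sup>2 \<le> (norm (y k - y0))\<^sup>2" using err_bound[OF k] by linarith
  then show "norm (y k - x k) \<le> norm (y k - y0)" using power2_le_imp_le norm_ge_zero by blast
  have "2 * A k * err k \<le> (norm (y k - y0))\<^sup>2"
    using err_bound[OF k] zero_le_power2[of "norm (y k - x k)"] by linarith
  then show "err k \<le> (norm (y k - y0))\<^sup>2 / (2 * A k)" using A_pos[OF k] by (simp add: field_simps)
qed

lemma norm_r_le:
  assumes k: "1 \<le> k" and "norm (y k - x k) \<le> c * norm (y k - y0)"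
  shows "norm (r k) \<le> (1 + c) * norm (y k - y0) / A k"
proof -
  have "A k * norm (r k) = norm ((y k - x k) - (y k - y0))"
    using arg_cong[OF scaled_r[OF k], of norm] A_pos[OF k] by simp
  also have "\<dots> \<le> norm (y k - x k) + norm (y k - y0)" by (rule norm_triangle_ineq4)
  also have "\<dots> \<le> (1 + c) * norm (y k - y0)" using assms(2) by (simp add: distrib_right)
  finally show ?thesis using A_pos[OF k] by (simp add: field_simps)
qed

lemma residual_bounds:
  "norm (y k - y0) - norm (r k) \<le> residual k" "residual k \<le> norm (y k - y0) + norm (r k)"
  using norm_triangle_ineq[of "y0 - y k" "r k"] norm_diff_ineq[of "y0 - y k" "r k"]
  by (simp_all add: norm_minus_commute)

text \<open>With p the distance of \<open>y k\<close> to the start, the left side of the test is at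
  most (13/9) p^2 / A and the residual is at least (7/9) p. So \<open>A k \<ge> 9 / \<sigma>\<close>
  leaves 13/81 against 49/81.\<close>

lemma rel_error_eventually:
  assumes \<sigma>: "0 < \<sigma>" "\<sigma> < 1" and k: "1 \<le> k" and A: "A k \<ge> 9 / \<sigma>"
  shows "acg_rel_error \<psi>s \<psi>n y0 \<sigma> (state k)"
proof -
  define p where "p = norm (y k - y0)"
  have p: "p \<ge> 0" by (simp add: p_def)
  have "9 \<le> 9 / \<sigma>" using \<sigma> by (simp add: field_simps)
  then have A9: "A k \<ge> 9" using A by linarith
  have A\<sigma>: "9 / A k \<le> \<sigma>" using A \<sigma> A9 by (simp add: field_simps)
  have r: "norm (r k) \<le> 2 * p / A k"
    using norm_r_le[OF k, of 1] distance_bounds(1)[OF k] by (simp add: p_def)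
  also have "\<dots> \<le> 2 * p / 9" using A9 p by (intro divide_left_mono) auto
  finally have "7 / 9 * p \<le> residual k" using residual_bounds(1)[of k] unfolding p_def by linarith
  then have res: "49 / 81 * p\<^sup>2 \<le> (residual k)\<^sup>2"
    using power_mono[of "7 / 9 * p" "residual k" 2] p by (simp add: power_mult_distrib power_divide)
  have "(norm (r k))\<^sup>2 \<le> (2 * p / A k)\<^sup>2" using r by (intro power_mono) auto
  also have "\<dots> = 4 / A k * (p\<^sup>2 / A k)" by (simp add: power2_eq_square)
  also have "\<dots> \<le> 4 / 9 * (p\<^sup>2 / A k)" using A9 by (intro mult_right_mono) (auto simp: field_simps)
  finally have "(norm (r k))\<^sup>2 + 2 * err k \<le> 13 / 9 * (p\<^sup>2 / A k)"
    using distance_bounds(2)[OF k] A9 by (simp add: p_def field_simps)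
  also have "\<dots> = 13 / 81 * p\<^sup>2 * (9 / A k)" by simp
  also have "\<dots> \<le> 13 / 81 * p\<^sup>2 * \<sigma>" using A\<sigma> by (intro mult_left_mono) auto
  also have "\<dots> \<le> \<sigma> * (49 / 81 * p\<^sup>2)" using \<sigma> by (simp add: mult_right_mono)
  also have "\<dots> \<le> \<sigma> * (residual k)\<^sup>2" using res \<sigma> by (intro mult_left_mono) auto
  finally show ?thesis unfolding acg_rel_error_def .
qed

text \<open>Both iterates lie close to the minimizer of \<open>\<psi>\<close> compared with \<open>y0\<close>; adding
  \<open>descent\<close> for the two indices avoids mentioning that minimizer.\<close>

lemma later_residual:
  assumes k: "1 \<le> k" "k \<le> j" and A: "A k \<ge> max 8 (9 / \<mu>)"
  shows "norm (y j - y0) \<le> 3 * residual k" and "residual j \<le> 5 * residual k"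
proof -
  have close: "norm (y i - x i) \<le> norm (y i - y0) / 3" "norm (r i) \<le> norm (y i - y0) / 6"
    if i: "1 \<le> i" and Ai: "A i \<ge> max 8 (9 / \<mu>)" for i
  proof -
    have \<mu>A: "\<mu> * A i \<ge> 9" using Ai \<mu> by (simp add: field_simps)
    \<comment> \<open>Comparing the iterate with itself cancels the objective values in
      \<open>descent\<close>.\<close>
    have "(1 + \<mu> * A i) * (norm (y i - x i))\<^sup>2 \<le> (norm (y i - y0))\<^sup>2"
      using descent[OF y_in[of i], of i] by simp
    moreover have "10 * (norm (y i - x i))\<^sup>2 \<le> (1 + \<mu> * A i) * (norm (y i - x i))\<^sup>2"
      using \<mu>A by (intro mult_right_mono) auto
    ultimately have "9 * (norm (y i - x i))\<^sup>2 \<le> (norm (y i - y0))\<^sup>2"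
      using zero_le_power2[of "norm (y i - x i)"] by linarith
    then have "(3 * norm (y i - x i))\<^sup>2 \<le> (norm (y i - y0))\<^sup>2" by (simp add: power_mult_distrib)
    then have "3 * norm (y i - x i) \<le> norm (y i - y0)" using power2_le_imp_le norm_ge_zero by blast
    then show 1: "norm (y i - x i) \<le> norm (y i - y0) / 3" by simp
    have "norm (r i) \<le> (1 + 1 / 3) * norm (y i - y0) / A i" using norm_r_le[OF i, of "1 / 3"] 1 by simp
    also have "\<dots> \<le> (1 + 1 / 3) * norm (y i - y0) / 8" using Ai by (intro divide_left_mono) auto
    finally show "norm (r i) \<le> norm (y i - y0) / 6" by simp
  qed
  define p where "p = norm (y k - y0)"
  define p' where "p' = norm (y j - y0)"
  have j: "1 \<le> j" "A j \<ge> max 8 (9 / \<mu>)" using k A A_mono[OF k(2)] by auto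
  have "\<psi> (y j) - \<psi> (y k) \<le> p\<^sup>2 / (2 * A j)"
  proof -
    have "0 \<le> (1 + \<mu> * A j) / 2 * (norm (y k - x j))\<^sup>2" using \<mu> A_nonneg[of j] by simp
    then have "A j * (\<psi> (y j) - \<psi> (y k)) \<le> p\<^sup>2 / 2"
      using descent[OF y_in[of k], of j] by (simp add: p_def right_diff_distrib)
    then show ?thesis using A_pos[OF j(1)] by (simp add: field_simps)
  qed
  also have "\<dots> \<le> p\<^sup>2 / (2 * A k)"
    using A_mono[OF k(2)] A_pos[OF k(1)] by (intro divide_left_mono) auto
  finally have "A k * (\<psi> (y j) - \<psi> (y k)) \<le> p\<^sup>2 / 2"
    using A_pos[OF k(1)] by (simp add: field_simps)
  then have "(1 + \<mu> * A k) * (norm (y j - x k))\<^sup>2 \<le> p'\<^sup>2 + p\<^sup>2"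
    using descent[OF y_in[of j], of k] by (simp add: p'_def algebra_simps add_divide_distrib)
  moreover have "10 * (norm (y j - x k))\<^sup>2 \<le> (1 + \<mu> * A k) * (norm (y j - x k))\<^sup>2"
    using A \<mu> by (intro mult_right_mono) (auto simp: field_simps)
  ultimately have "9 * (norm (y j - x k))\<^sup>2 \<le> p'\<^sup>2 + p\<^sup>2"
    using zero_le_power2[of "norm (y j - x k)"] by linarith
  moreover have "0 \<le> 2 * p' * p" by (simp add: p_def p'_def)
  ultimately have "(3 * norm (y j - x k))\<^sup>2 \<le> (p' + p)\<^sup>2"
    unfolding power_mult_distrib power2_sum by (simp del: zero_le_mult_iff)
  then have "3 * norm (y j - x k) \<le> p' + p"
    by (rule power2_le_imp_le) (simp add: p_def p'_def)
  moreover have "p' \<le> p + norm (y j - x k) + norm (y k - x k)"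
  proof -
    have "y j - y0 = (y k - y0) + ((y j - x k) - (y k - x k))" by simp
    then have "p' \<le> p + norm ((y j - x k) - (y k - x k))"
      unfolding p_def p'_def by (metis norm_triangle_ineq)
    then show ?thesis using norm_triangle_ineq4[of "y j - x k" "y k - x k"] by linarith
  qed
  \<comment> \<open>This solves p' \<le> p + (p' + p)/3 + p/3. Residuals differ from distances by at
    most a sixth, so the residual ratio is at most (7/6)(5/2)(6/5) = 7/2, below the 5
    claimed.\<close>
  ultimately have p': "p' \<le> 5 / 2 * p" using close(1)[OF k(1) A] by (simp add: p_def)
  have "5 / 6 * p \<le> residual k"
    using close(2)[OF k(1) A] residual_bounds(1)[of k] by (simp add: p_def)
  moreover have "residual j \<le> 7 / 6 * p'"
    using close(2)[OF j] residual_bounds(2)[of j] by (simp add: p'_def)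
  ultimately show "norm (y j - y0) \<le> 3 * residual k" "residual j \<le> 5 * residual k"
    using p' norm_ge_zero[of "y0 - y k + r k"] unfolding p'_def by linarith+
qed

section \<open>Growth of the weights and iteration counts of ACG\<close>

lemma A_quadratic: "real k / (2 * sqrt L) \<le> sqrt (A k)"
proof (induction k)
  case (Suc k)
  have "1 / L \<le> (1 + \<mu> * A k) / L" using \<mu> L A_nonneg[of k] by (intro divide_right_mono) auto
  then have "1 / sqrt L \<le> sqrt ((1 + \<mu> * A k) / L)"
    by (metis real_sqrt_divide real_sqrt_le_iff real_sqrt_one)
  then have "real k / (2 * sqrt L) + 1 / (2 * sqrt L) \<le> sqrt (A (Suc k))"
    using Suc sqrt_A_step[of k] by simp
  then show ?case by (simp add: add_divide_distrib)
qed simp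

text \<open>The term \<open>\<mu> * A k\<close> in the step size multiplies sqrt A by at least 1 +
  sqrt (\<mu>/L)/2. The index is shifted because \<open>A 0 = 0\<close>: growth can only start from
  A 1 = 1/L.\<close>

lemma A_geometric: "(1 + sqrt (\<mu> / L) / 2) ^ k / sqrt L \<le> sqrt (A (Suc k))"
proof (induction k)
  case 0
  have "A (Suc 0) = 1 / L" using L unfolding A_step by (simp add: acg_a_def Let_def real_sqrt_divide power_divide)
  then show ?case by (simp add: real_sqrt_divide)
next
  case (Suc k)
  have "\<mu> / L * A (Suc k) \<le> (1 + \<mu> * A (Suc k)) / L"
    using L by (simp add: add_divide_distrib)
  then have "sqrt (\<mu> / L) * sqrt (A (Suc k)) \<le> sqrt ((1 + \<mu> * A (Suc k)) / L)"
    by (metis real_sqrt_le_iff real_sqrt_mult)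
  then have "(1 + sqrt (\<mu> / L) / 2) * sqrt (A (Suc k)) \<le> sqrt (A (Suc (Suc k)))"
    using sqrt_A_step[of "Suc k"] by (simp add: distrib_right del: acg.simps)
  moreover have "(1 + sqrt (\<mu> / L) / 2) * ((1 + sqrt (\<mu> / L) / 2) ^ k / sqrt L)
      \<le> (1 + sqrt (\<mu> / L) / 2) * sqrt (A (Suc k))"
    using Suc \<mu> L by (intro mult_left_mono) auto
  ultimately show ?case by simp
qed

lemma A_large_sublinear:
  assumes "0 < \<sigma>" "\<sigma> < 1"
  shows "\<exists>k\<ge>1. real k \<le> 7 * sqrt (L / min \<sigma> \<mu>) \<and> A k \<ge> 9 / min \<sigma> \<mu>"
proof -
  define s where "s = sqrt (L / min \<sigma> \<mu>)"
  \<comment> \<open>The 6 yields sqrt A \<ge> 3 / sqrt (min \<sigma> \<mu>), enough for both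
    thresholds 9/\<sigma> and 9/\<mu>; rounding up costs at most s since s \<ge> 1, whence the
    7.\<close>
  define k where "k = nat \<lceil>6 * s\<rceil>"
  have mn: "0 < min \<sigma> \<mu>" "min \<sigma> \<mu> \<le> 1" using assms \<mu> by auto
  have "1 \<le> L / min \<sigma> \<mu>" using mn L by (simp add: field_simps)
  then have s: "1 \<le> s" by (simp add: s_def)
  have k: "6 * s \<le> real k" "real k \<le> 6 * s + 1" using s unfolding k_def by linarith+
  have "3 / sqrt (min \<sigma> \<mu>) = 6 * s / (2 * sqrt L)"
    using L unfolding s_def real_sqrt_divide by simp
  also have "\<dots> \<le> real k / (2 * sqrt L)" using k L by (intro divide_right_mono) auto
  also have "\<dots> \<le> sqrt (A k)" by (rule A_quadratic)
  finally have "(3 / sqrt (min \<sigma> \<mu>))\<^sup>2 \<le> (sqrt (A k))\<^sup>2" using mn by (intro power_mono) auto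
  then have "9 / min \<sigma> \<mu> \<le> A k" using mn A_nonneg by (simp add: power_divide)
  moreover have "1 \<le> k" "real k \<le> 7 * s" using k s by linarith+
  ultimately show ?thesis unfolding s_def by blast
qed

lemma A_large_logarithmic:
  "\<exists>k\<ge>1. real k \<le> 2 + 4 * ln L * sqrt (L / \<mu>) \<and> A k \<ge> L"
proof -
  define s where "s = sqrt (\<mu> / L)"
  have "\<mu> / L \<le> 1" using \<mu> L by (simp add: field_simps)
  then have s: "0 < s" "s \<le> 1" using \<mu> L by (auto simp: s_def)
  have s_inv: "1 / s = sqrt (L / \<mu>)" by (simp add: s_def real_sqrt_divide)
  \<comment> \<open>From 1/L to L the weight grows by L^2, its square root by L; as ln (1 + s/2)
    \<ge> s/4, this many factors suffice.\<close>
  define n where "n = nat \<lceil>4 * ln L / s\<rceil>"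
  have "0 \<le> 4 * ln L / s" using L s by simp
  then have n: "4 * ln L / s \<le> real n" "real n \<le> 4 * ln L / s + 1" unfolding n_def by linarith+
  have "s / 2 * (s / 2) \<le> s / 2 * (1 / 2)" using s by (intro mult_left_mono) auto
  then have "s / 4 \<le> s / 2 - (s / 2)\<^sup>2" unfolding power2_eq_square by simp
  also have "\<dots> \<le> ln (1 + s / 2)" using s by (intro ln_one_plus_pos_lower_bound) auto
  finally have "real n * (s / 4) \<le> real n * ln (1 + s / 2)" by (intro mult_left_mono) auto
  moreover have "ln L \<le> real n * (s / 4)" using n s by (simp add: field_simps)
  ultimately have "ln L \<le> ln ((1 + s / 2) ^ n)" using s by (simp add: ln_realpow)
  then have "L \<le> (1 + s / 2) ^ n" using s L by (subst (asm) ln_le_cancel_iff) auto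
  then have "L / sqrt L \<le> (1 + s / 2) ^ n / sqrt L" using L by (intro divide_right_mono) auto
  also have "\<dots> \<le> sqrt (A (Suc n))" unfolding s_def by (rule A_geometric)
  finally have "sqrt L \<le> sqrt (A (Suc n))" using L by (simp add: real_div_sqrt)
  then have "L \<le> A (Suc n)" by (simp del: acg.simps)
  moreover have "real (Suc n) \<le> 2 + 4 * ln L * sqrt (L / \<mu>)"
    using n unfolding s_inv[symmetric] by simp
  ultimately show ?thesis by (intro exI[of _ "Suc n"]) simp
qed

lemma acg1_terminates:
  assumes \<sigma>: "0 < \<sigma>" "\<sigma> < 1"
  shows "\<exists>k. acg1_stops \<psi>s \<psi>n y0 \<mu> L \<sigma> k \<and> real k \<le> 7 * sqrt (L / min \<sigma> \<mu>)"
proof -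
  obtain j where j: "1 \<le> j" "real j \<le> 7 * sqrt (L / min \<sigma> \<mu>)" "A j \<ge> 9 / min \<sigma> \<mu>"
    using A_large_sublinear[OF \<sigma>] by blast
  have mn: "0 < min \<sigma> \<mu>" using \<sigma> \<mu> by simp
  have "9 / \<sigma> \<le> 9 / min \<sigma> \<mu>" "9 / \<mu> \<le> 9 / min \<sigma> \<mu>"
    using mn \<sigma> \<mu> by (auto intro!: divide_left_mono)
  moreover have "8 \<le> 9 / \<sigma>" using \<sigma> by (simp add: field_simps)
  ultimately have A: "9 / \<sigma> \<le> A j" "max 8 (9 / \<mu>) \<le> A j" using j(3) by auto
  have "\<exists>k\<le>j. acg1_stops \<psi>s \<psi>n y0 \<mu> L \<sigma> k"
    unfolding acg1_stops_def
    by (intro first_from_exists[OF j(1)] conjI rel_error_eventually[OF \<sigma> j(1) A(1)] A(2))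
  then obtain k where k: "k \<le> j" "acg1_stops \<psi>s \<psi>n y0 \<mu> L \<sigma> k" by blast
  have "real k \<le> real j" using k(1) by simp
  then show ?thesis using k(2) j(2) by (intro exI[of _ k]) linarith
qed

text \<open>At later indices the distance to the centre is at most 3 \<delta>, so the error is at
  most 9 \<delta>^2 / (2 A). The hypothesis on \<open>\<eta>\<close> makes this small enough once A
  reaches \<open>L\<close>.\<close>

lemma acg2_terminates:
  assumes \<sigma>: "0 < \<sigma>" "\<sigma> < 1" and k0: "acg1_stops \<psi>s \<psi>n y0 \<mu> L \<sigma> k0"
    and \<delta>: "residual k0 \<le> \<delta>" and \<eta>: "9 / 2 * \<delta>\<^sup>2 \<le> \<eta> * L"
  shows "\<exists>k\<ge>k0. acg2_stops \<psi>s \<psi>n y0 \<mu> L \<sigma> \<eta> k0 k \<and>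
    real k \<le> 7 * sqrt (L / min \<sigma> \<mu>) + 2 + 4 * ln L * sqrt (L / \<mu>)"
proof -
  let ?s = "sqrt (L / min \<sigma> \<mu>)"
  have k0': "1 \<le> k0" "A k0 \<ge> max 8 (9 / \<mu>)"
    using k0 unfolding acg1_stops_def first_from_def by auto
  have mn: "0 < min \<sigma> \<mu>" using \<sigma> \<mu> by simp
  obtain i where i: "acg1_stops \<psi>s \<psi>n y0 \<mu> L \<sigma> i" "real i \<le> 7 * ?s"
    using acg1_terminates[OF \<sigma>] by blast
  \<comment> \<open>A first index is unique, so the known bound on some stopping index applies to
    \<open>k0\<close>.\<close>
  have "i = k0"
    using i(1) k0 unfolding acg1_stops_def first_from_def by (metis linorder_neqE_nat)
  with i have k0_le: "real k0 \<le> 7 * ?s" by simp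
  obtain k1 where k1: "1 \<le> k1" "real k1 \<le> 7 * ?s" "A k1 \<ge> 9 / min \<sigma> \<mu>"
    using A_large_sublinear[OF \<sigma>] by blast
  obtain k2 where k2: "1 \<le> k2" "real k2 \<le> 2 + 4 * ln L * sqrt (L / \<mu>)" "A k2 \<ge> L"
    using A_large_logarithmic by blast
  define j where "j = max k0 (max k1 k2)"
  have j: "1 \<le> j" "k0 \<le> j" using k0' by (auto simp: j_def)
  have "9 / \<sigma> \<le> 9 / min \<sigma> \<mu>" using mn \<sigma> by (intro divide_left_mono) auto
  moreover have "A k1 \<le> A j" "A k2 \<le> A j" by (auto intro!: A_mono simp: j_def)
  ultimately have Aj: "9 / \<sigma> \<le> A j" "L \<le> A j" using k1(3) k2(3) by auto
  have "norm (y j - y0) \<le> 3 * \<delta>"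
    using later_residual(1)[OF k0'(1) j(2) k0'(2)] \<delta> by linarith
  then have "(norm (y j - y0))\<^sup>2 \<le> (3 * \<delta>)\<^sup>2" by (intro power_mono) auto
  then have "(norm (y j - y0))\<^sup>2 \<le> 2 * (\<eta> * L)" using \<eta> by (simp add: power_mult_distrib)
  have \<eta>0: "0 \<le> \<eta>"
  proof -
    have "0 \<le> \<eta> * L" using \<eta> zero_le_power2[of \<delta>] by linarith
    then show ?thesis using L by (simp add: zero_le_mult_iff)
  qed
  have "err j \<le> (norm (y j - y0))\<^sup>2 / (2 * A j)" by (rule distance_bounds(2)[OF j(1)])
  also have "\<dots> \<le> 2 * (\<eta> * L) / (2 * A j)"
    using \<open>_ \<le> 2 * (\<eta> * L)\<close> A_nonneg by (intro divide_right_mono) auto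
  also have "\<dots> \<le> \<eta>"
    using Aj(2) A_pos[OF j(1)] mult_left_mono[OF Aj(2) \<eta>0] by (simp add: field_simps)
  finally have "err j \<le> \<eta>" .
  then have "\<exists>k\<le>j. acg2_stops \<psi>s \<psi>n y0 \<mu> L \<sigma> \<eta> k0 k"
    unfolding acg2_stops_def
    by (intro first_from_exists[OF j(2)] conjI rel_error_eventually[OF \<sigma> j(1) Aj(1)])
  then obtain k where k: "k \<le> j" "acg2_stops \<psi>s \<psi>n y0 \<mu> L \<sigma> \<eta> k0 k" by blast
  have "0 \<le> ln L * sqrt (L / \<mu>)" "0 \<le> ?s" using L \<mu> mn by auto
  then have "real j \<le> 7 * ?s + 2 + 4 * ln L * sqrt (L / \<mu>)"
    using k0_le k1(2) k2(2) unfolding j_def by (simp add: max_def)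
  moreover have "real k \<le> real j" using k(1) by simp
  moreover have "k0 \<le> k" using k(2) unfolding acg2_stops_def first_from_def by blast
  ultimately show ?thesis using k(2) by (intro exI[of _ k]) auto
qed

end

section \<open>The inexact proximal point method\<close>

lemma closed_convex_on_scaled:
  fixes h :: "'a::euclidean_space \<Rightarrow> ereal"
  assumes h: "closed_convex_on Z h" and lam: "lam > 0"
  shows "closed_convex_on Z (scaled lam h)"
  unfolding closed_convex_on_def
proof (intro conjI)
  have ninf: "h u \<noteq> - \<infinity>" for u using h by (simp add: closed_convex_on_def)
  show "\<forall>z. scaled lam h z \<noteq> - \<infinity>"
    using ninf lam by (auto simp: scaled_def)
  show "\<exists>z. scaled lam h z \<noteq> \<infinity>"
    using h lam by (auto simp: scaled_def closed_convex_on_def)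
  have "h x \<le> Liminf (at x) h" for x using h by (auto simp: closed_convex_on_def lsc_def)
  then have "ereal lam * h x \<le> ereal lam * Liminf (at x) h" for x
    using lam by (intro ereal_mult_left_mono) auto
  then show "lsc (scaled lam h)"
    unfolding lsc_def scaled_def using lam by (simp add: Liminf_ereal_mult_left)
  show "convex_ereal (scaled lam h)"
    unfolding convex_ereal_def
  proof (intro allI ballI)
    fix x y :: 'a and t :: real assume t: "t \<in> {0<..<1}"
    let ?w = "(1 - t) *\<^sub>R x + t *\<^sub>R y"
    have "h ?w \<le> ereal (1 - t) * h x + ereal t * h y"
      using h t by (auto simp: closed_convex_on_def convex_ereal_def)
    then have "ereal lam * h ?w \<le> ereal lam * (ereal (1 - t) * h x + ereal t * h y)"
      using lam by (intro ereal_mult_left_mono) auto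
    also have "\<dots> = ereal (1 - t) * (ereal lam * h x) + ereal t * (ereal lam * h y)"
      using t lam ninf[of x] ninf[of y]
      by (cases "h x"; cases "h y") (auto simp: algebra_simps)
    finally show "scaled lam h ?w \<le> ereal (1 - t) * scaled lam h x + ereal t * scaled lam h y"
      by (simp add: scaled_def)
  qed
  show "{z. scaled lam h z < \<infinity>} = Z"
    using h lam by (auto simp: scaled_def closed_convex_on_def ereal_mult_less_right)
qed

text \<open>Linearizing half the squared distance leaves exactly half the squared increment, so the
  prox term adds 1 to both curvature constants: the origin of \<open>1 - lam * m\<close> and
  \<open>1 + lam * M\<close>.\<close>

lemma linearization_prox_smooth:
  fixes f :: "'a::euclidean_space \<Rightarrow> real"
  assumes "f differentiable (at x)"
  shows "linearization (prox_smooth f lam z) x u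
    = lam * linearization f x u + ((norm (u - z))\<^sup>2 - (norm (u - x))\<^sup>2) / 2"
proof -
  have "GDERIV f x :> grad f x" using assms by (rule differentiable_GDERIV_grad)
  then have f': "(f has_derivative (\<lambda>d. d \<bullet> grad f x)) (at x)" by (simp add: gderiv_def)
  have "((\<lambda>u. (u - z) \<bullet> (u - z)) has_derivative (\<lambda>d. 2 * (d \<bullet> (x - z)))) (at x)"
    by (auto intro!: derivative_eq_intros simp: inner_commute)
  from has_derivative_add[OF has_derivative_mult_right[OF f', of lam] has_derivative_mult_right[OF this, of "1 / 2"]]
  have "((\<lambda>u. lam * f u + (norm (u - z))\<^sup>2 / 2) has_derivative
      (\<lambda>d. d \<bullet> (lam *\<^sub>R grad f x + (x - z)))) (at x)"
    by (simp add: power2_norm_eq_inner inner_add_right)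
  then have g: "grad (prox_smooth f lam z) x = lam *\<^sub>R grad f x + (x - z)"
    by (intro grad_eq) (simp add: gderiv_def prox_smooth_def[abs_def])
  show ?thesis
    unfolding linearization_def g prox_smooth_def norm_sq_shift[of u z x]
    by (simp add: inner_add_left distrib_left add_divide_distrib)
qed

text \<open>The estimate \<open>L\<parallel>zhat - y\<parallel> \<le> \<parallel>w\<parallel> + \<rho>/4\<close> passes through the minimizer of the model tilted by \<open>w\<close>:
  it is close to \<open>y\<close> because \<open>y\<close> nearly solves the prox subproblem, and close to
  \<open>zhat\<close> because proximal maps are nonexpansive.\<close>

lemma refine_step:
  fixes Z :: "'a::euclidean_space set"
  assumes h: "closed_convex_on Z h" and y: "y \<in> Z" and lam: "lam > 0" and M: "M > 0"
    and L: "L = M + 1 / lam"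
    and upper: "\<And>u. u \<in> Z \<Longrightarrow> f u \<le> linearization f y u + M / 2 * (norm (u - y))\<^sup>2"
    and lipschitz: "\<And>u. u \<in> Z \<Longrightarrow> norm (grad f u - grad f y) \<le> L * norm (u - y)"
    and near: "\<And>u. u \<in> Z \<Longrightarrow> f y + real_part h y + w \<bullet> (u - y) - \<epsilon>
      \<le> f u + real_part h u + (norm (u - y))\<^sup>2 / (2 * lam)"
    and w: "norm w \<le> \<rho> / 4" and \<epsilon>: "\<epsilon> \<le> \<rho>\<^sup>2 / (32 * L)" and \<rho>: "\<rho> > 0"
  shows "refine_z f h L y \<in> Z"
    and "f (refine_z f h L y) + real_part h (refine_z f h L y) \<le> f y + real_part h y"
    and "norm (refine_v f h L y) \<le> \<rho>"
    and "refine_v f h L y - grad f (refine_z f h L y) \<in> subdifferential h (refine_z f h L y)"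
proof -
  define zh where "zh = refine_z f h L y"
  define G where "G u = linearization f y u + real_part h u + L / 2 * (norm (u - y))\<^sup>2" for u
  define Gw where "Gw u = G u - w \<bullet> (u - y)" for u
  define gw where "gw u = ereal 1 * h u
    + ereal (f y + (grad f y - w) \<bullet> (u - y) + L / 2 * (norm (u - y))\<^sup>2)" for u
  define zw where "zw = argmin gw"
  have L0: "L > 0" using lam M by (simp add: L add_pos_pos)
  have g: "ereal (linearization f y u) + h u + ereal (L / 2 * (norm (u - y))\<^sup>2)
    = ereal 1 * h u + ereal (f y + grad f y \<bullet> (u - y) + L / 2 * (norm (u - y))\<^sup>2)" for u
    by (cases "h u") (simp_all add: linearization_def)
  have G: "G u = 1 * real_part h u + (f y + grad f y \<bullet> (u - y) + L / 2 * (norm (u - y))\<^sup>2)" for u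
    by (simp add: G_def linearization_def)
  have Gw: "Gw u = 1 * real_part h u + (f y + (grad f y - w) \<bullet> (u - y) + L / 2 * (norm (u - y))\<^sup>2)" for u
    by (simp add: Gw_def G inner_diff_left)
  have zhZ: "zh \<in> Z"
    unfolding zh_def refine_z_def by (rule prox_argmin(1)[OF h _ L0 g G]) simp
  have zh: "G zh + L / 2 * (norm (u - zh))\<^sup>2 \<le> G u" if "u \<in> Z" for u
    unfolding zh_def refine_z_def by (rule prox_argmin(2)[OF h _ L0 g G that]) simp
  have zwZ: "zw \<in> Z"
    unfolding zw_def by (rule prox_argmin(1)[OF h _ L0 gw_def Gw]) simp
  have zw: "Gw zw + L / 2 * (norm (u - zw))\<^sup>2 \<le> Gw u" if "u \<in> Z" for u
    unfolding zw_def by (rule prox_argmin(2)[OF h _ L0 gw_def Gw that]) simp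
  have Gy: "G y = f y + real_part h y" by (simp add: G_def linearization_def)
  have G_upper: "f u + real_part h u + (norm (u - y))\<^sup>2 / (2 * lam) \<le> G u" if "u \<in> Z" for u
  proof -
    have "L / 2 * (norm (u - y))\<^sup>2 = M / 2 * (norm (u - y))\<^sup>2 + (norm (u - y))\<^sup>2 / (2 * lam)"
      using lam by (simp add: L field_simps)
    then show ?thesis using upper[OF that] unfolding G_def by linarith
  qed
  show "refine_z f h L y \<in> Z" using zhZ by (simp add: zh_def)
  have "0 \<le> L / 2 * (norm (y - zh))\<^sup>2" "0 \<le> (norm (zh - y))\<^sup>2 / (2 * lam)" using L0 lam by auto
  then have "f zh + real_part h zh \<le> f y + real_part h y"
    using zh[OF y] G_upper[OF zhZ] unfolding Gy by linarith
  then show "f (refine_z f h L y) + real_part h (refine_z f h L y) \<le> f y + real_part h y"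
    by (simp add: zh_def)
  \<comment> \<open>The tilted model lies above the tilted prox objective and agrees with it at
    \<open>y\<close>, so \<open>y\<close> minimizes it up to \<open>\<epsilon>\<close>. The 32 in
    the tolerance turns this into distance \<open>\<rho> / 4\<close> after scaling by
    \<open>L\<close>.\<close>
  have "L / 2 * (norm (y - zw))\<^sup>2 \<le> \<epsilon>"
    using zw[OF y] G_upper[OF zwZ] near[OF zwZ] by (simp add: Gw_def Gy)
  then have "2 * L * (L / 2 * (norm (y - zw))\<^sup>2) \<le> 2 * L * (\<rho>\<^sup>2 / (32 * L))"
    using L0 \<epsilon> by (intro mult_left_mono) auto
  moreover have "2 * L * (L / 2 * (norm (y - zw))\<^sup>2) = (L * norm (y - zw))\<^sup>2"
    by (simp add: power2_eq_square)
  moreover have "2 * L * (\<rho>\<^sup>2 / (32 * L)) = (\<rho> / 4)\<^sup>2"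
    using L0 by (simp add: power_divide)
  ultimately have "(L * norm (y - zw))\<^sup>2 \<le> (\<rho> / 4)\<^sup>2" by simp
  then have y_zw: "L * norm (y - zw) \<le> \<rho> / 4" by (rule power2_le_imp_le) (use \<rho> in simp)
  \<comment> \<open>Adding the growth inequalities of the two minimizers, each tested at the other,
    leaves only the tilt.\<close>
  have "L * norm (zw - zh) \<le> norm w"
  proof (cases "zw = zh")
    case False
    have "L * (norm (zw - zh))\<^sup>2 \<le> w \<bullet> (zw - zh)"
      using zh[OF zwZ] zw[OF zhZ] by (simp add: Gw_def norm_minus_commute[of zh zw] inner_diff_right)
    also have "\<dots> \<le> norm w * norm (zw - zh)" by (rule norm_cauchy_schwarz)
    finally have "(L * norm (zw - zh)) * norm (zw - zh) \<le> norm w * norm (zw - zh)"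
      by (simp add: power2_eq_square mult.assoc)
    then show ?thesis using False by simp
  qed simp
  moreover have "L * norm (y - zh) \<le> L * (norm (y - zw) + norm (zw - zh))"
    using L0 norm_triangle_ineq[of "y - zw" "zw - zh"] by (intro mult_left_mono) auto
  ultimately have d: "L * norm (y - zh) \<le> \<rho> / 2" using y_zw w by (simp add: distrib_left)
  have v: "refine_v f h L y = L *\<^sub>R (y - zh) + (grad f zh - grad f y)"
    by (simp add: refine_v_def zh_def)
  have "norm (refine_v f h L y) \<le> norm (L *\<^sub>R (y - zh)) + norm (grad f zh - grad f y)"
    unfolding v by (rule norm_triangle_ineq)
  also have "\<dots> \<le> L * norm (y - zh) + L * norm (y - zh)"
    using lipschitz[OF zhZ] L0 by (simp add: norm_minus_commute[of zh y])
  finally show "norm (refine_v f h L y) \<le> \<rho>" using d by linarith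
  \<comment> \<open>The growth term of the three-point inequality cancels the recentred quadratic,
    so what remains is affine in \<open>u\<close>.\<close>
  have "h zh + ereal ((L *\<^sub>R (y - zh) - grad f y) \<bullet> (u - zh)) \<le> h u" for u
  proof (cases "u \<in> Z")
    case True
    have "(y - zh) \<bullet> (u - zh) = - ((zh - y) \<bullet> (u - zh))" by (simp add: inner_diff_left)
    moreover have "grad f y \<bullet> (u - y) = grad f y \<bullet> (zh - y) + grad f y \<bullet> (u - zh)"
      by (simp add: inner_diff_right)
    ultimately have "real_part h zh + (L *\<^sub>R (y - zh) - grad f y) \<bullet> (u - zh) \<le> real_part h u"
      using zh[OF True] unfolding G_def linearization_def norm_sq_shift[of u y zh]
      by (simp add: inner_diff_left[of _ "grad f y"] algebra_simps add_divide_distrib)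
    then show ?thesis
      using closed_convex_on_finite[OF h True] closed_convex_on_finite[OF h zhZ] by simp
  next
    case False
    then show ?thesis using closed_convex_on_infinite[OF h] by simp
  qed
  moreover have "\<bar>h zh\<bar> \<noteq> \<infinity>" using closed_convex_on_finite[OF h zhZ] by simp
  ultimately show "refine_v f h L y - grad f (refine_z f h L y) \<in> subdifferential h (refine_z f h L y)"
    unfolding v zh_def[symmetric] subdifferential_def by simp
qed

text \<open>\<open>M\<close> stands for the curvature of the penalized function, which is at least
  1/lam > m for the penalties used; hence \<open>m \<le> M\<close>, and \<open>max m M\<close> is
  \<open>M\<close> throughout.\<close>

locale inexact_proximal_point =
  fixes Z :: "'a::euclidean_space set" and f :: "'a \<Rightarrow> real" and h :: "'a \<Rightarrow> ereal"
    and lam m M \<sigma> \<rho> :: real and z0 :: 'a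
  assumes h: "closed_convex_on Z h" and z0: "z0 \<in> Z"
    and m: "0 < m" "m \<le> M" and lam: "0 < lam" "lam * m < 1"
    and \<sigma>: "0 < \<sigma>" "\<sigma> < 1" and \<rho>: "0 < \<rho>"
    and upper: "\<And>z u. z \<in> Z \<Longrightarrow> u \<in> Z \<Longrightarrow> f u \<le> linearization f z u + M / 2 * (norm (u - z))\<^sup>2"
    and lipschitz: "\<And>z u. z \<in> Z \<Longrightarrow> u \<in> Z \<Longrightarrow> norm (grad f u - grad f z) \<le> (M + 1 / lam) * norm (u - z)"
    and curvature: "\<And>z k. aipp_centre f h lam m M \<sigma> \<rho> z0 z \<Longrightarrow>
      curvature_bounds_at m M Z f (acg_xt (1 - lam * m) (1 + lam * M) (aipp_acg f h lam m M z k))"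
begin

abbreviation "\<mu> \<equiv> 1 - lam * m"
abbreviation "L \<equiv> 1 + lam * M"
abbreviation "run \<equiv> aipp_run f h lam m M \<sigma> \<rho>"
abbreviation "centre \<equiv> aipp_centre f h lam m M \<sigma> \<rho> z0"

definition \<phi> :: "'a \<Rightarrow> real" where
  "\<phi> u = f u + real_part h u"

definition cost1 :: real where
  "cost1 = 7 * sqrt (L / min \<sigma> \<mu>)"

definition cost2 :: real where
  "cost2 = 7 * sqrt (L / min \<sigma> \<mu>) + 2 + 4 * ln L * sqrt (L / \<mu>)"

definition good :: "'a \<times> 'a \<Rightarrow> bool" where
  "good zv \<longleftrightarrow> fst zv \<in> Z \<and> norm (snd zv) \<le> \<rho> \<and>
    snd zv - grad f (fst zv) \<in> subdifferential h (fst zv)"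

lemma \<mu>: "0 < \<mu>" "\<mu> \<le> 1" and L: "1 \<le> L"
  using m lam by auto

lemma accelerated_gradient:
  assumes z: "z \<in> Z" "centre z"
  shows "accelerated_gradient Z (prox_smooth f lam z) (scaled lam h) z \<mu> L"
proof
  show "closed_convex_on Z (scaled lam h)" using closed_convex_on_scaled[OF h] lam by blast
  show "z \<in> Z" "0 < \<mu>" "\<mu> \<le> 1" "1 \<le> L" using z \<mu> L by auto
next
  fix k u xt
  assume u: "u \<in> Z" and xt: "xt = acg_xt \<mu> L (acg (prox_smooth f lam z) (scaled lam h) z \<mu> L k)"
  then have c: "curvature_bounds_at m M Z f xt"
    using curvature[OF z(2), of k] by (simp add: aipp_acg_def)
  then have lin: "linearization (prox_smooth f lam z) xt u
    = lam * linearization f xt u + ((norm (u - z))\<^sup>2 - (norm (u - xt))\<^sup>2) / 2"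
    by (intro linearization_prox_smooth) (simp add: curvature_bounds_at_def)
  have "- (m / 2) * (norm (u - xt))\<^sup>2 \<le> f u - linearization f xt u"
    "f u - linearization f xt u \<le> M / 2 * (norm (u - xt))\<^sup>2"
    using c u unfolding curvature_bounds_at_def by blast+
  then have b: "lam * (- (m / 2) * (norm (u - xt))\<^sup>2) \<le> lam * (f u - linearization f xt u)"
    "lam * (f u - linearization f xt u) \<le> lam * (M / 2 * (norm (u - xt))\<^sup>2)"
    using lam by (intro mult_left_mono; simp)+
  show "linearization (prox_smooth f lam z) xt u + \<mu> / 2 * (norm (u - xt))\<^sup>2 \<le> prox_smooth f lam z u"
    unfolding lin prox_smooth_def using b(1) by (simp add: algebra_simps diff_divide_distrib add_divide_distrib)
  show "prox_smooth f lam z u \<le> linearization (prox_smooth f lam z) xt u + L / 2 * (norm (u - xt))\<^sup>2"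
    unfolding lin prox_smooth_def using b(2) by (simp add: algebra_simps diff_divide_distrib add_divide_distrib)
qed

lemma \<psi>_eq:
  assumes "z \<in> Z" "centre z"
  shows "accelerated_gradient.\<psi> (prox_smooth f lam z) (scaled lam h) u = lam * \<phi> u + (norm (u - z))\<^sup>2 / 2"
  unfolding accelerated_gradient.\<psi>_def[OF accelerated_gradient[OF assms]] \<phi>_def prox_smooth_def
  by (simp add: real_part_def scaled_def algebra_simps)

text \<open>Expanding the squared residual lets the relative error test absorb both the norm of
  \<open>r\<close> and the error (\<open>main\<close> in the proof). The centre as comparison point
  gives descent; an arbitrary one leaves an inner product with \<open>r\<close>.\<close>

lemma inexact_prox:
  assumes z: "z \<in> Z" "centre z" and k: "1 \<le> k"
    and s: "s = acg (prox_smooth f lam z) (scaled lam h) z \<mu> L k"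
    and rel: "acg_rel_error (prox_smooth f lam z) (scaled lam h) z \<sigma> s"
  shows "st_y s \<in> Z"
    and "u \<in> Z \<Longrightarrow> lam * \<phi> (st_y s) + (z - st_y s + acg_r z s) \<bullet> (u - st_y s)
      - acg_eta (prox_smooth f lam z) (scaled lam h) z s \<le> lam * \<phi> u + (norm (u - st_y s))\<^sup>2 / 2"
    and "lam * \<phi> (st_y s) + (1 - \<sigma>) / 2 * (norm (z - st_y s + acg_r z s))\<^sup>2 \<le> lam * \<phi> z"
    and "u \<in> Z \<Longrightarrow> lam * \<phi> (st_y s) \<le> lam * \<phi> u + (norm (u - z))\<^sup>2 / (2 * (1 - \<sigma>))"
proof -
  interpret G: accelerated_gradient Z "prox_smooth f lam z" "scaled lam h" z \<mu> L
    by (rule accelerated_gradient[OF z])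
  define y where "y = st_y s"
  define r where "r = acg_r z s"
  define e where "e = acg_eta (prox_smooth f lam z) (scaled lam h) z s"
  define R where "R = (norm (z - y + r))\<^sup>2"
  have e0: "0 \<le> e" unfolding e_def s by (rule G.err_nonneg[OF k])
  have re: "(norm r)\<^sup>2 + 2 * e \<le> \<sigma> * R"
    using rel unfolding acg_rel_error_def r_def e_def y_def R_def .
  have sub: "lam * \<phi> y + (norm (y - z))\<^sup>2 / 2 + r \<bullet> (u - y) - e \<le> lam * \<phi> u + (norm (u - z))\<^sup>2 / 2"
    if "u \<in> Z" for u
    using G.approximate_subgradient[OF k that] unfolding \<psi>_eq[OF z] y_def r_def e_def s .
  show yZ: "st_y s \<in> Z" unfolding s by (rule G.y_in)
  show "lam * \<phi> (st_y s) + (z - st_y s + acg_r z s) \<bullet> (u - st_y s)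
      - acg_eta (prox_smooth f lam z) (scaled lam h) z s \<le> lam * \<phi> u + (norm (u - st_y s))\<^sup>2 / 2"
    if u: "u \<in> Z"
  proof -
    have "(z - y + r) \<bullet> (u - y) = r \<bullet> (u - y) - (y - z) \<bullet> (u - y)"
      by (simp add: inner_add_left inner_diff_left)
    then show ?thesis
      using sub[OF u] unfolding norm_sq_shift[of u z y] y_def[symmetric] r_def[symmetric] e_def[symmetric]
      by (simp add: add_divide_distrib)
  qed
  have main: "lam * \<phi> y + (1 - \<sigma>) / 2 * R + r \<bullet> (u - z) \<le> lam * \<phi> u + (norm (u - z))\<^sup>2 / 2"
    if u: "u \<in> Z" for u
  proof -
    have "R = (norm (y - z))\<^sup>2 + 2 * (r \<bullet> (z - y)) + (norm r)\<^sup>2"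
      unfolding R_def norm_add_sq by (simp add: norm_minus_commute inner_commute)
    moreover have "r \<bullet> (u - y) = r \<bullet> (u - z) + r \<bullet> (z - y)" by (simp add: inner_diff_right)
    ultimately show ?thesis using sub[OF u] re by (simp add: algebra_simps diff_divide_distrib)
  qed
  show "lam * \<phi> (st_y s) + (1 - \<sigma>) / 2 * (norm (z - st_y s + acg_r z s))\<^sup>2 \<le> lam * \<phi> z"
    using main[OF z(1)] by (simp add: R_def y_def r_def)
  show "lam * \<phi> (st_y s) \<le> lam * \<phi> u + (norm (u - z))\<^sup>2 / (2 * (1 - \<sigma>))" if u: "u \<in> Z"
  proof -
    let ?d = "u - z"
    have "(norm r)\<^sup>2 \<le> \<sigma> * R" using re e0 by linarith
    then have "(1 - \<sigma>) * ((norm r)\<^sup>2) \<le> (1 - \<sigma>) * (\<sigma> * R)" using \<sigma> by (intro mult_left_mono) auto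
    then have "(1 - \<sigma>) * ((1 - \<sigma>) * (norm r)\<^sup>2) \<le> (1 - \<sigma>) * ((1 - \<sigma>) * (\<sigma> * R))"
      using \<sigma> by (intro mult_left_mono) auto
    \<comment> \<open>Young's inequality, weighted so that the inner product costs \<sigma> / (2 (1
      - \<sigma>)) times the squared distance; together with the original 1/2 this makes 1 / (2 (1 -
      \<sigma>)).\<close>
    moreover have "0 \<le> (norm ((1 - \<sigma>) *\<^sub>R r + \<sigma> *\<^sub>R ?d))\<^sup>2" by simp
    moreover have "(norm ((1 - \<sigma>) *\<^sub>R r + \<sigma> *\<^sub>R ?d))\<^sup>2 = (1 - \<sigma>) * ((1 - \<sigma>) * (norm r)\<^sup>2)
        + 2 * ((1 - \<sigma>) * \<sigma> * (r \<bullet> ?d)) + \<sigma> * \<sigma> * (norm ?d)\<^sup>2"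
      unfolding norm_add_sq norm_scaleR power_mult_distrib power2_abs by (simp add: power2_eq_square)
    moreover have "(2 * \<sigma>) * ((1 - \<sigma>) * ((1 - \<sigma>) / 2 * R + r \<bullet> ?d) + \<sigma> / 2 * (norm ?d)\<^sup>2)
      = (1 - \<sigma>) * ((1 - \<sigma>) * (\<sigma> * R)) + 2 * ((1 - \<sigma>) * \<sigma> * (r \<bullet> ?d)) + \<sigma> * \<sigma> * (norm ?d)\<^sup>2"
      by (simp add: distrib_left mult.assoc mult.left_commute)
    ultimately have "0 \<le> (2 * \<sigma>) * ((1 - \<sigma>) * ((1 - \<sigma>) / 2 * R + r \<bullet> ?d) + \<sigma> / 2 * (norm ?d)\<^sup>2)"
      by linarith
    then have "0 \<le> (1 - \<sigma>) * ((1 - \<sigma>) / 2 * R + r \<bullet> ?d) + \<sigma> / 2 * (norm ?d)\<^sup>2"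
      using \<sigma> by (simp add: zero_le_mult_iff)
    moreover have "(1 - \<sigma>) * (lam * \<phi> y + ((1 - \<sigma>) / 2 * R + r \<bullet> ?d))
        \<le> (1 - \<sigma>) * (lam * \<phi> u + (norm ?d)\<^sup>2 / 2)"
      using main[OF u] \<sigma> by (intro mult_left_mono) auto
    ultimately have "(1 - \<sigma>) * (lam * \<phi> y) \<le> (1 - \<sigma>) * (lam * \<phi> u) + (norm ?d)\<^sup>2 / 2"
      unfolding distrib_left[of "1 - \<sigma>" "lam * _"] left_diff_distrib[of _ _ "(norm ?d)\<^sup>2 / 2"] by simp
    also have "\<dots> = (1 - \<sigma>) * (lam * \<phi> u + (norm ?d)\<^sup>2 / (2 * (1 - \<sigma>)))"
      using \<sigma> by (simp add: field_simps)
    finally show ?thesis using \<sigma> unfolding y_def by simp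
  qed
qed

section \<open>Termination and cost of the outer loop\<close>

lemma call1_exists:
  assumes "z \<in> Z" "centre z"
  shows "\<exists>k. aipp_call1 f h lam m M \<sigma> z k \<and> real k \<le> cost1"
  using accelerated_gradient.acg1_terminates[OF accelerated_gradient[OF assms] \<sigma>]
  by (simp add: aipp_call1_def cost1_def)

lemma call1D:
  assumes "aipp_call1 f h lam m M \<sigma> z k"
  shows "1 \<le> k" and "acg_rel_error (prox_smooth f lam z) (scaled lam h) z \<sigma> (aipp_acg f h lam m M z k)"
    and "max 8 (9 / \<mu>) \<le> st_A (aipp_acg f h lam m M z k)"
  using assms by (auto simp: aipp_call1_def acg1_stops_def first_from_def aipp_acg_def)

lemma finish_exists:
  assumes z: "z \<in> Z" "centre z" and k: "aipp_call1 f h lam m M \<sigma> z k" "real k \<le> cost1"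
    and small: "aipp_small_residual lam \<rho> z (aipp_acg f h lam m M z k)"
  shows "\<exists>zv n. run z zv n \<and> real n \<le> cost1 + cost2 \<and> good zv \<and>
    (\<forall>u\<in>Z. lam * \<phi> (fst zv) \<le> lam * \<phi> u + (norm (u - z))\<^sup>2 / (2 * (1 - \<sigma>)))"
proof -
  interpret G: accelerated_gradient Z "prox_smooth f lam z" "scaled lam h" z \<mu> L
    by (rule accelerated_gradient[OF z])
  define \<epsilon> where "\<epsilon> = \<rho>\<^sup>2 / (32 * (max m M + 1 / lam))"
  define Ll where "Ll = max m M + 1 / lam"
  have Ll: "Ll = M + 1 / lam" "lam * Ll = L" using m lam by (simp_all add: Ll_def max_def field_simps)
  have Ll0: "0 < Ll" unfolding Ll(1) using m lam by (simp add: add_pos_pos)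
  have res: "G.residual k \<le> lam * \<rho> / 20"
    using small by (simp add: aipp_small_residual_def aipp_acg_def)
  \<comment> \<open>With \<delta> = lam \<rho> / 20 the requirement of the second call reads 9/800
    \<le> 1/32; \<open>lam * Ll = L\<close> removes all other parameters.\<close>
  have "lam * \<epsilon> * L = (lam * \<rho>)\<^sup>2 / 32"
    unfolding Ll(2)[symmetric] \<epsilon>_def Ll_def[symmetric] using Ll0 by (simp add: power2_eq_square)
  moreover have "9 / 2 * (lam * \<rho> / 20)\<^sup>2 = 9 / 800 * (lam * \<rho>)\<^sup>2"
    by (simp add: power_divide)
  ultimately have "9 / 2 * (lam * \<rho> / 20)\<^sup>2 \<le> lam * \<epsilon> * L"
    using zero_le_power2[of "lam * \<rho>"] by linarith
  from G.acg2_terminates[OF \<sigma> k(1)[unfolded aipp_call1_def] res this] obtain k' where k': "k \<le> k'"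
    "acg2_stops (prox_smooth f lam z) (scaled lam h) z \<mu> L \<sigma> (lam * \<epsilon>) k k'" "real k' \<le> cost2"
    unfolding cost2_def by blast
  define s where "s = G.state k'"
  have s: "s = aipp_acg f h lam m M z k'" by (simp add: s_def aipp_acg_def)
  let ?e = "acg_eta (prox_smooth f lam z) (scaled lam h) z s"
  have rel: "acg_rel_error (prox_smooth f lam z) (scaled lam h) z \<sigma> s" and e: "?e \<le> lam * \<epsilon>"
    using k'(2) by (auto simp: acg2_stops_def first_from_def s_def)
  have k1: "1 \<le> k'" using call1D(1)[OF k(1)] k'(1) by simp
  note prox = inexact_prox[OF z k1 s_def rel]
  define y where "y = st_y s"
  have yZ: "y \<in> Z" using prox(1) by (simp add: y_def)
  define w where "w = (1 / lam) *\<^sub>R (z - y + acg_r z s)"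
  \<comment> \<open>Fivefold growth is affordable: 5/20 is the 1/4 that the refinement asks of
    \<open>w\<close>.\<close>
  have "G.residual k' \<le> 5 * G.residual k"
    using call1D[OF k(1)] k'(1) by (intro G.later_residual(2)) (auto simp: aipp_acg_def)
  then have "norm (z - y + acg_r z s) \<le> lam * \<rho> / 4" using res by (simp add: y_def s_def)
  moreover have "norm w = norm (z - y + acg_r z s) / lam" using lam by (simp add: w_def)
  ultimately have w: "norm w \<le> \<rho> / 4" using lam by (simp add: pos_divide_le_eq mult.commute)
  have near: "f y + real_part h y + w \<bullet> (u - y) - ?e / lam
      \<le> f u + real_part h u + (norm (u - y))\<^sup>2 / (2 * lam)" if u: "u \<in> Z" for u
  proof -
    have "(1 / lam) * (lam * \<phi> y + (z - y + acg_r z s) \<bullet> (u - y) - ?e)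
        \<le> (1 / lam) * (lam * \<phi> u + (norm (u - y))\<^sup>2 / 2)"
      using prox(2)[OF u] lam unfolding y_def by (intro mult_left_mono) auto
    moreover have "w \<bullet> (u - y) = (1 / lam) * ((z - y + acg_r z s) \<bullet> (u - y))"
      unfolding w_def by simp
    ultimately show ?thesis
      unfolding \<phi>_def distrib_left right_diff_distrib using lam by (simp add: algebra_simps)
  qed
  have \<epsilon>: "?e / lam \<le> \<rho>\<^sup>2 / (32 * Ll)" using e lam by (simp add: \<epsilon>_def Ll_def field_simps)
  have M: "M > 0" using m by simp
  note refine = refine_step[OF h yZ lam(1) M Ll(1) upper[OF yZ] lipschitz[OF yZ, folded Ll(1)] near w \<epsilon> \<rho>]
  let ?zv = "(refine_z f h Ll y, refine_v f h Ll y)"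
  have "run z ?zv (k + k')"
    using k(1) small k'(2) s
    by (intro aipp_finish) (auto simp: aipp_call2_def \<epsilon>_def Ll_def y_def)
  moreover have "good ?zv" using refine by (simp add: good_def)
  moreover have "lam * \<phi> (fst ?zv) \<le> lam * \<phi> u + (norm (u - z))\<^sup>2 / (2 * (1 - \<sigma>))" if "u \<in> Z" for u
  proof -
    have "lam * \<phi> (fst ?zv) \<le> lam * \<phi> y"
      using refine(2) lam by (intro mult_left_mono) (auto simp: \<phi>_def)
    also have "\<dots> \<le> lam * \<phi> u + (norm (u - z))\<^sup>2 / (2 * (1 - \<sigma>))"
      using prox(4)[OF that] by (simp add: y_def)
    finally show ?thesis .
  qed
  moreover have "real (k + k') \<le> cost1 + cost2" using k(2) k'(3) by simp
  ultimately show ?thesis by blast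
qed

definition decrease :: real where
  "decrease = (1 - \<sigma>) / 2 * (lam * \<rho> / 20)\<^sup>2"

lemma decrease_pos: "0 < decrease"
  using \<sigma> lam \<rho> by (simp add: decrease_def)

lemma cost1_nonneg: "0 \<le> cost1"
  using \<mu> L \<sigma> by (simp add: cost1_def)

lemma continue_step:
  assumes z: "z \<in> Z" "centre z" and k: "aipp_call1 f h lam m M \<sigma> z k"
    and large: "\<not> aipp_small_residual lam \<rho> z (aipp_acg f h lam m M z k)"
    and y: "y = st_y (aipp_acg f h lam m M z k)"
  shows "y \<in> Z" and "centre y" and "lam * \<phi> y + decrease \<le> lam * \<phi> z"
    and "u \<in> Z \<Longrightarrow> lam * \<phi> y \<le> lam * \<phi> u + (norm (u - z))\<^sup>2 / (2 * (1 - \<sigma>))"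
proof -
  have "aipp_acg f h lam m M z k = acg (prox_smooth f lam z) (scaled lam h) z \<mu> L k"
    by (simp add: aipp_acg_def)
  note prox = inexact_prox[OF z call1D(1)[OF k] this call1D(2)[OF k], folded y]
  show "y \<in> Z" "u \<in> Z \<Longrightarrow> lam * \<phi> y \<le> lam * \<phi> u + (norm (u - z))\<^sup>2 / (2 * (1 - \<sigma>))"
    using prox(1,4) .
  show "centre y" unfolding y using z(2) k large by (rule aipp_centre.intros(2))
  let ?R = "norm (z - y + acg_r z (aipp_acg f h lam m M z k))"
  have "lam * \<rho> / 20 \<le> ?R" using large by (simp add: aipp_small_residual_def y)
  then have "(lam * \<rho> / 20)\<^sup>2 \<le> ?R\<^sup>2" using lam \<rho> by (intro power_mono) auto
  then have "decrease \<le> (1 - \<sigma>) / 2 * ?R\<^sup>2" unfolding decrease_def using \<sigma> by (intro mult_left_mono) auto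
  then show "lam * \<phi> y + decrease \<le> lam * \<phi> z" using prox(3) by linarith
qed

text \<open>\<open>j\<close> bounds the number of drops that still fit in the objective gap. A step
  that is not the last lowers the ratio of gap to \<open>decrease\<close> by at least 1 and so pays
  for its own call.\<close>

lemma run_exists:
  assumes low: "\<And>u. u \<in> Z \<Longrightarrow> \<phi>min \<le> \<phi> u"
  shows "z \<in> Z \<Longrightarrow> centre z \<Longrightarrow> lam * (\<phi> z - \<phi>min) < real j * decrease \<Longrightarrow>
    \<exists>zv n. run z zv n \<and> good zv \<and> lam * \<phi> (fst zv) \<le> lam * \<phi> z \<and>
      real n \<le> cost1 * (lam * (\<phi> z - \<phi>min) / decrease) + cost1 + cost2"
proof (induction j arbitrary: z)
  case 0
  have "0 \<le> lam * (\<phi> z - \<phi>min)" using low[OF 0(1)] lam by simp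
  with 0(3) show ?case by simp
next
  case (Suc j)
  note z = Suc.prems(1,2)
  obtain k where k: "aipp_call1 f h lam m M \<sigma> z k" "real k \<le> cost1" using call1_exists[OF z] by blast
  show ?case
  proof (cases "aipp_small_residual lam \<rho> z (aipp_acg f h lam m M z k)")
    case True
    from finish_exists[OF z k True] obtain zv n where n: "run z zv n" "real n \<le> cost1 + cost2" "good zv"
      "\<And>u. u \<in> Z \<Longrightarrow> lam * \<phi> (fst zv) \<le> lam * \<phi> u + (norm (u - z))\<^sup>2 / (2 * (1 - \<sigma>))" by blast
    have "0 \<le> cost1 * (lam * (\<phi> z - \<phi>min) / decrease)"
      using low[OF z(1)] lam decrease_pos cost1_nonneg by simp
    then have "real n \<le> cost1 * (lam * (\<phi> z - \<phi>min) / decrease) + cost1 + cost2" using n(2) by linarith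
    moreover have "lam * \<phi> (fst zv) \<le> lam * \<phi> z" using n(4)[OF z(1)] by simp
    ultimately show ?thesis using n(1,3) by blast
  next
    case False
    define y where "y = st_y (aipp_acg f h lam m M z k)"
    note y = continue_step[OF z k(1) False y_def]
    have dec: "lam * (\<phi> y - \<phi>min) \<le> lam * (\<phi> z - \<phi>min) - decrease"
      using y(3) by (simp add: right_diff_distrib)
    then have "lam * (\<phi> y - \<phi>min) < real j * decrease"
      using Suc.prems(3) by (simp add: distrib_right)
    from Suc.IH[OF y(1,2) this] obtain zv n where n: "run y zv n" "good zv"
      "lam * \<phi> (fst zv) \<le> lam * \<phi> y" "real n \<le> cost1 * (lam * (\<phi> y - \<phi>min) / decrease) + cost1 + cost2" by blast
    have "run z zv (k + n)" using k(1) False n(1) unfolding y_def by (rule aipp_continue)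
    moreover have "lam * (\<phi> y - \<phi>min) / decrease \<le> lam * (\<phi> z - \<phi>min) / decrease - 1"
      using divide_right_mono[OF dec, of decrease] decrease_pos by (simp add: diff_divide_distrib)
    then have "cost1 * (lam * (\<phi> y - \<phi>min) / decrease) \<le> cost1 * (lam * (\<phi> z - \<phi>min) / decrease - 1)"
      using cost1_nonneg by (intro mult_left_mono) auto
    then have "real (k + n) \<le> cost1 * (lam * (\<phi> z - \<phi>min) / decrease) + cost1 + cost2"
      using n(4) k(2) by (simp add: right_diff_distrib)
    moreover have "lam * \<phi> (fst zv) \<le> lam * \<phi> z" using n(3) y(3) decrease_pos by linarith
    ultimately show ?thesis using n(2) by blast
  qed
qed

text \<open>The call of the first step plus the two calls of the last one. The number 23 is 7 + 7 +
  7 + 2, as the square root is at least 1.\<close>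

lemma cost2_le: "cost1 + cost1 + cost2 \<le> sqrt (L / min \<sigma> \<mu>) * (23 + 4 * ln L)"
proof -
  have mn: "0 < min \<sigma> \<mu>" "min \<sigma> \<mu> \<le> 1" using \<sigma> \<mu> by auto
  define s where "s = sqrt (L / min \<sigma> \<mu>)"
  have "1 \<le> L / min \<sigma> \<mu>" using mn L by (simp add: field_simps)
  then have 1: "1 \<le> s" by (simp add: s_def)
  have "L / \<mu> \<le> L / min \<sigma> \<mu>" using mn L \<mu> by (intro divide_left_mono) auto
  then have "4 * ln L * sqrt (L / \<mu>) \<le> 4 * ln L * s"
    unfolding s_def using L by (intro mult_left_mono) auto
  moreover have "s * (23 + 4 * ln L) = 23 * s + 4 * ln L * s" by (simp add: distrib_left)
  ultimately show ?thesis using 1 unfolding cost1_def cost2_def s_def[symmetric] by linarith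
qed

text \<open>Only the first step is compared with an arbitrary \<open>u\<close>; from then on the objective decreases
  by at least \<open>decrease\<close> at every step that is not the last.\<close>

theorem terminates:
  assumes low: "\<And>u. u \<in> Z \<Longrightarrow> \<phi>min \<le> \<phi> u"
  shows "\<exists>z v n. run z0 (z, v) n \<and> z \<in> Z \<and> norm v \<le> \<rho> \<and> v - grad f z \<in> subdifferential h z \<and>
    (\<forall>u\<in>Z. lam * \<phi> z \<le> lam * \<phi> u + (norm (u - z0))\<^sup>2 / (2 * (1 - \<sigma>))) \<and>
    (\<forall>u\<in>Z. real n \<le> sqrt (L / min \<sigma> \<mu>) *
      (5600 * ((norm (u - z0))\<^sup>2 / 2 + lam * (\<phi> u - \<phi>min)) / ((1 - \<sigma>)\<^sup>2 * lam\<^sup>2 * \<rho>\<^sup>2) + 23 + 4 * ln L))"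
proof -
  define s where "s = sqrt (L / min \<sigma> \<mu>)"
  have s0: "0 \<le> s" using \<mu> L \<sigma> by (simp add: s_def)
  define V where "V u = (norm (u - z0))\<^sup>2 / 2 + lam * (\<phi> u - \<phi>min)" for u
  have V0: "0 \<le> V u" if "u \<in> Z" for u using low[OF that] lam by (simp add: V_def)
  define D where "D = (1 - \<sigma>)\<^sup>2 * lam\<^sup>2 * \<rho>\<^sup>2"
  have D: "0 < D" using \<sigma> lam \<rho> by (simp add: D_def)
  have c: "centre z0" by (rule aipp_centre.intros(1))
  obtain k where k: "aipp_call1 f h lam m M \<sigma> z0 k" "real k \<le> cost1" using call1_exists[OF z0 c] by blast
  have "\<exists>zv n. run z0 zv n \<and> good zv \<and>
    (\<forall>u\<in>Z. lam * \<phi> (fst zv) \<le> lam * \<phi> u + (norm (u - z0))\<^sup>2 / (2 * (1 - \<sigma>))) \<and>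
    (\<forall>u\<in>Z. real n \<le> s * (5600 * V u / D) + (cost1 + cost1 + cost2))"
  proof (cases "aipp_small_residual lam \<rho> z0 (aipp_acg f h lam m M z0 k)")
    case True
    from finish_exists[OF z0 c k True] obtain zv n where n: "run z0 zv n" "real n \<le> cost1 + cost2" "good zv"
      "\<forall>u\<in>Z. lam * \<phi> (fst zv) \<le> lam * \<phi> u + (norm (u - z0))\<^sup>2 / (2 * (1 - \<sigma>))" by blast
    have "real n \<le> s * (5600 * V u / D) + (cost1 + cost1 + cost2)" if "u \<in> Z" for u
    proof -
      have "0 \<le> s * (5600 * V u / D)" using s0 V0[OF that] D by simp
      then show ?thesis using n(2) cost1_nonneg by linarith
    qed
    then show ?thesis using n by blast
  next
    case False
    define y where "y = st_y (aipp_acg f h lam m M z0 k)"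
    note y = continue_step[OF z0 c k(1) False y_def]
    obtain j :: nat where "lam * (\<phi> y - \<phi>min) / decrease < real j" using reals_Archimedean2 by blast
    then have "lam * (\<phi> y - \<phi>min) < real j * decrease" using decrease_pos by (simp add: field_simps)
    from run_exists[OF low y(1,2) this] obtain zv n where n: "run y zv n" "good zv"
      "lam * \<phi> (fst zv) \<le> lam * \<phi> y" "real n \<le> cost1 * (lam * (\<phi> y - \<phi>min) / decrease) + cost1 + cost2" by blast
    have "run z0 zv (k + n)" using k(1) False n(1) unfolding y_def by (rule aipp_continue)
    moreover have "\<forall>u\<in>Z. lam * \<phi> (fst zv) \<le> lam * \<phi> u + (norm (u - z0))\<^sup>2 / (2 * (1 - \<sigma>))"
      using n(3) y(4) by (meson order_trans)
    moreover have "real (k + n) \<le> s * (5600 * V u / D) + (cost1 + cost1 + cost2)" if u: "u \<in> Z" for u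
    proof -
      have "lam * (\<phi> y - \<phi>min) \<le> (norm (u - z0))\<^sup>2 / (2 * (1 - \<sigma>)) + lam * (\<phi> u - \<phi>min)"
        using y(4)[OF u] by (simp add: right_diff_distrib)
      moreover have "lam * (\<phi> u - \<phi>min) \<le> lam * (\<phi> u - \<phi>min) / (1 - \<sigma>)"
        using low[OF u] lam \<sigma> by (simp add: field_simps)
      ultimately have "lam * (\<phi> y - \<phi>min) \<le> V u / (1 - \<sigma>)"
        unfolding V_def by (simp add: add_divide_distrib)
      then have "lam * (\<phi> y - \<phi>min) / decrease \<le> V u / (1 - \<sigma>) / decrease"
        using decrease_pos by (intro divide_right_mono) auto
      \<comment> \<open>800 = 2 * 20^2 comes from \<open>decrease\<close>, whose factor 1 - \<sigma>
        joins that of the first step; the 7 in \<open>cost1\<close> makes it 5600.\<close>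
      also have "\<dots> = 800 * V u / D"
        using \<sigma> lam \<rho> by (simp add: decrease_def D_def field_simps power2_eq_square)
      finally have "cost1 * (lam * (\<phi> y - \<phi>min) / decrease) \<le> cost1 * (800 * V u / D)"
        using cost1_nonneg by (intro mult_left_mono) auto
      also have "\<dots> = s * (5600 * V u / D)" by (simp add: cost1_def s_def)
      finally show ?thesis using n(4) k(2) by simp
    qed
    ultimately show ?thesis using n(2) by blast
  qed
  then obtain zv n where *: "run z0 zv n" "good zv"
    "\<forall>u\<in>Z. lam * \<phi> (fst zv) \<le> lam * \<phi> u + (norm (u - z0))\<^sup>2 / (2 * (1 - \<sigma>))"
    "\<forall>u\<in>Z. real n \<le> s * (5600 * V u / D) + (cost1 + cost1 + cost2)" by blast
  have "real n \<le> s * (5600 * V u / D + 23 + 4 * ln L)" if "u \<in> Z" for u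
    using *(4) that cost2_le unfolding s_def[symmetric] by (fastforce simp: distrib_left)
  then show ?thesis
    using * unfolding good_def s_def V_def D_def by (metis prod.collapse)
qed

end

section \<open>The quadratic penalty method\<close>

context
  fixes S :: "'b::euclidean_space set" and A :: "'a::euclidean_space \<Rightarrow> 'b"
  assumes S: "closed S" "convex S" "S \<noteq> {}" and A: "linear A"
begin

lemma norm_linear_le: "norm (A u - A x) \<le> onorm A * norm (u - x)"
  using onorm[of A "u - x"] A by (simp add: linear_conv_bounded_linear linear_diff)

lemma GDERIV_penalized:
  assumes "f differentiable (at x)"
  shows "GDERIV (penalized f A S c) x :> grad f x + c *\<^sub>R adjoint A (A x - closest_point S (A x))"
  unfolding penalized_def[abs_def]
  by (rule GDERIV_add[OF differentiable_GDERIV_grad[OF assms] GDERIV_half_infdist_sq[OF S A]])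

lemma linearization_penalized:
  assumes "f differentiable (at x)"
  shows "linearization (penalized f A S c) x u = linearization f x u
    + c * ((infdist (A x) S)\<^sup>2 / 2 + (A x - closest_point S (A x)) \<bullet> (A u - A x))"
  unfolding linearization_def grad_eq[OF GDERIV_penalized[OF assms]] penalized_def
  using A by (simp add: inner_add_left adjoint_clauses linear_diff algebra_simps)

text \<open>The penalty is convex, so the lower constant \<open>m\<close> is kept; being 1-smooth
  before composition with \<open>A\<close>, it raises only the upper constant.\<close>

lemma curvature_bounds_at_penalized:
  assumes f: "curvature_bounds_at m M Z f x" and c: "0 \<le> c"
  shows "curvature_bounds_at m (M + c * (onorm A)\<^sup>2) Z (penalized f A S c) x"
  unfolding curvature_bounds_at_def
proof (intro conjI ballI)
  have d: "f differentiable (at x)" using f by (simp add: curvature_bounds_at_def)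
  show "penalized f A S c differentiable (at x)"
    using GDERIV_penalized[OF d, of c] unfolding gderiv_def differentiable_def by blast
  fix u assume u: "u \<in> Z"
  let ?a = "A x - closest_point S (A x)"
  have eq: "penalized f A S c u - linearization (penalized f A S c) x u = f u - linearization f x u
      + c * ((infdist (A u) S)\<^sup>2 / 2 - (infdist (A x) S)\<^sup>2 / 2 - ?a \<bullet> (A u - A x))"
    unfolding linearization_penalized[OF d] penalized_def by (simp add: algebra_simps)
  have f': "- (m / 2) * (norm (u - x))\<^sup>2 \<le> f u - linearization f x u"
    "f u - linearization f x u \<le> M / 2 * (norm (u - x))\<^sup>2"
    using f u unfolding curvature_bounds_at_def by blast+
  have "0 \<le> c * ((infdist (A u) S)\<^sup>2 / 2 - (infdist (A x) S)\<^sup>2 / 2 - ?a \<bullet> (A u - A x))"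
    using half_infdist_sq_lower[OF S, of "A x" "A u"] c by (intro mult_nonneg_nonneg) auto
  then show "- (m / 2) * (norm (u - x))\<^sup>2
      \<le> penalized f A S c u - linearization (penalized f A S c) x u"
    unfolding eq using f'(1) by linarith
  have "(norm (A u - A x))\<^sup>2 \<le> (onorm A)\<^sup>2 * (norm (u - x))\<^sup>2"
    using power_mono[OF norm_linear_le[of u x], of 2] by (simp add: power_mult_distrib)
  then have "(infdist (A u) S)\<^sup>2 / 2 - (infdist (A x) S)\<^sup>2 / 2 - ?a \<bullet> (A u - A x)
      \<le> (onorm A)\<^sup>2 * (norm (u - x))\<^sup>2 / 2"
    using half_infdist_sq_upper[OF S, of "A u" "A x"] by simp
  from mult_left_mono[OF this c]
  show "penalized f A S c u - linearization (penalized f A S c) x u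
      \<le> (M + c * (onorm A)\<^sup>2) / 2 * (norm (u - x))\<^sup>2"
    unfolding eq using f'(2) by (simp add: algebra_simps add_divide_distrib)
qed

lemma grad_penalized_lipschitz:
  assumes d: "f differentiable (at u)" "f differentiable (at x)" and c: "0 \<le> c"
    and f: "norm (grad f u - grad f x) \<le> K * norm (u - x)"
  shows "norm (grad (penalized f A S c) u - grad (penalized f A S c) x)
    \<le> (K + c * (onorm A)\<^sup>2) * norm (u - x)"
proof -
  let ?b = "(A u - closest_point S (A u)) - (A x - closest_point S (A x))"
  have A': "bounded_linear A" using A by (simp add: linear_conv_bounded_linear)
  \<comment> \<open>This bounds the adjoint through \<open>onorm A\<close>: one norm of the adjoint
    vector cancels from its square.\<close>
  have "norm (adjoint A ?b) * norm (adjoint A ?b) = A (adjoint A ?b) \<bullet> ?b"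
    by (simp add: power2_norm_eq_inner[unfolded power2_eq_square] adjoint_works[OF A])
  also have "\<dots> \<le> norm (A (adjoint A ?b)) * norm ?b" by (rule norm_cauchy_schwarz)
  also have "\<dots> \<le> onorm A * norm (adjoint A ?b) * (onorm A * norm (u - x))"
    using onorm[OF A', of "adjoint A ?b"] onorm_pos_le[OF A']
      closest_point_residual_nonexpansive[OF S, of "A u" "A x"] norm_linear_le[of u x]
    by (intro mult_mono) auto
  finally have "norm (adjoint A ?b) * norm (adjoint A ?b)
      \<le> norm (adjoint A ?b) * ((onorm A)\<^sup>2 * norm (u - x))"
    by (simp add: power2_eq_square mult_ac)
  then have "norm (adjoint A ?b) \<le> (onorm A)\<^sup>2 * norm (u - x)"
    by (cases "norm (adjoint A ?b) = 0") (auto simp: mult_le_cancel_left)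
  from mult_left_mono[OF this c]
  have 1: "norm (c *\<^sub>R adjoint A ?b) \<le> c * (onorm A)\<^sup>2 * norm (u - x)" using c by (simp add: mult.assoc)
  have "linear (adjoint A)" using A by (rule adjoint_linear)
  then have "grad (penalized f A S c) u - grad (penalized f A S c) x
      = (grad f u - grad f x) + c *\<^sub>R adjoint A ?b"
    unfolding grad_eq[OF GDERIV_penalized[OF d(1)]] grad_eq[OF GDERIV_penalized[OF d(2)]]
    by (simp only: linear_diff scaleR_diff_right) simp
  then have "norm (grad (penalized f A S c) u - grad (penalized f A S c) x)
      \<le> norm (grad f u - grad f x) + norm (c *\<^sub>R adjoint A ?b)"
    by (simp only: norm_triangle_ineq)
  then show ?thesis using 1 f by (simp add: distrib_right)
qed

end

locale quadratic_penalty =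
  fixes Z :: "'a::euclidean_space set" and h :: "'a \<Rightarrow> ereal" and f :: "'a \<Rightarrow> real"
    and A :: "'a \<Rightarrow> 'b::euclidean_space" and S :: "'b set"
    and m M chat \<rho> \<eta> \<sigma> lam R T \<Theta> :: real and z0 :: 'a
  assumes h: "closed_convex_on Z h"
    and m: "m > 0" and M: "M > 0" and f: "curvature_class m M Z f"
    and A: "linear A" "A \<noteq> (\<lambda>_. 0)" and S: "closed S" "convex S" "S \<noteq> {}"
    and chat: "chat > 0" and bounded_below: "(INF z. penalized_obj f h A S chat z) > -\<infinity>"
    and \<rho>: "\<rho> > 0" and \<eta>: "\<eta> > 0" and \<sigma>: "0 < \<sigma>" "\<sigma> < 1" and lam: "0 < lam" "lam * m < 1"
    and z0: "z0 \<in> Z" and lipschitz: "(max m M)-lipschitz_on Z (grad f)"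
    and curvature: "\<And>x. x \<in> linearization_points f h A S lam m M \<sigma> \<rho> \<eta> z0 (aipqp_c1 A chat M lam) \<Longrightarrow>
      curvature_bounds_at m M Z f x"
    and R: "prox_gap {z. A z \<in> S} lam (penalized_obj f h A S chat) z0 = ereal R"
    and T: "T = T_bound chat R \<eta> lam \<sigma>" and \<Theta>: "\<Theta> = M + T * (onorm A)\<^sup>2"
begin

abbreviation "c1 \<equiv> aipqp_c1 A chat M lam"
abbreviation "Mc c \<equiv> M + c * (onorm A)\<^sup>2"
abbreviation "penalty \<equiv> aipqp_penalty f h A S lam m M \<sigma> \<rho> \<eta> z0 c1"

definition \<phi>c :: "real \<Rightarrow> 'a \<Rightarrow> real" where
  "\<phi>c c u = penalized f A S c u + real_part h u"

definition \<phi>min :: real where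
  "\<phi>min = real_of_ereal (INF z. penalized_obj f h A S chat z)"

section \<open>Penalty parameters and the infimum over feasible points\<close>

lemma onorm_pos: "0 < onorm A"
  using A onorm_pos_lt linear_conv_bounded_linear by (metis (no_types, lifting))

lemma c1_pos: "chat < c1" "M + 1 / lam \<le> c1 * (onorm A)\<^sup>2"
  "c1 * (onorm A)\<^sup>2 = chat * (onorm A)\<^sup>2 + M + 1 / lam"
proof -
  show eq: "c1 * (onorm A)\<^sup>2 = chat * (onorm A)\<^sup>2 + M + 1 / lam"
    using onorm_pos unfolding aipqp_c1_def distrib_right by simp
  have "0 \<le> chat * (onorm A)\<^sup>2" using chat by simp
  then show "M + 1 / lam \<le> c1 * (onorm A)\<^sup>2" unfolding eq by linarith
  show "chat < c1" using onorm_pos M lam by (simp add: aipqp_c1_def add_pos_pos)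
qed

lemma penalized_obj_finite: "u \<in> Z \<Longrightarrow> penalized_obj f h A S c u = ereal (\<phi>c c u)"
  using closed_convex_on_finite[OF h] by (simp add: penalized_obj_def \<phi>c_def)

lemma INF_penalized_obj: "(INF z. penalized_obj f h A S chat z) = ereal \<phi>min"
proof -
  have "(INF z. penalized_obj f h A S chat z) \<le> ereal (\<phi>c chat z0)"
    unfolding penalized_obj_finite[OF z0, symmetric] by (rule INF_lower) simp
  then show ?thesis
    using bounded_below unfolding \<phi>min_def
    by (cases "INF z. penalized_obj f h A S chat z") auto
qed

lemma \<phi>c_split: "\<phi>c c u = \<phi>c chat u + (c - chat) / 2 * (infdist (A u) S)\<^sup>2"
  by (simp add: \<phi>c_def penalized_def algebra_simps diff_divide_distrib)

text \<open>The surplus over \<open>\<phi>min\<close> is what later forces near feasibility for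
  large \<open>c\<close>.\<close>

lemma \<phi>c_lower:
  assumes "u \<in> Z"
  shows "\<phi>min + (c - chat) / 2 * (infdist (A u) S)\<^sup>2 \<le> \<phi>c c u"
proof -
  have "(INF z. penalized_obj f h A S chat z) \<le> penalized_obj f h A S chat u" by (rule INF_lower) simp
  then have "\<phi>min \<le> \<phi>c chat u" unfolding INF_penalized_obj penalized_obj_finite[OF assms] by simp
  then show ?thesis by (simp add: \<phi>c_split[of c])
qed

definition gap :: "'a \<Rightarrow> real" where
  "gap u = (norm (u - z0))\<^sup>2 / 2 + lam * (\<phi>c chat u - \<phi>min)"

text \<open>Transfers a bound that is uniform over feasible points of \<open>Z\<close> to the
  infimum, without a minimizer; feasible points outside \<open>Z\<close> contribute
  \<infinity>.\<close>

lemma le_R: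
  assumes "\<And>u. u \<in> Z \<Longrightarrow> A u \<in> S \<Longrightarrow> t \<le> gap u"
  shows "t \<le> R"
proof -
  have "ereal t \<le> prox_gap {z. A z \<in> S} lam (penalized_obj f h A S chat) z0"
    unfolding prox_gap_def INF_penalized_obj
  proof (rule INF_greatest)
    fix u assume u: "u \<in> {z. A z \<in> S}"
    show "ereal t \<le> ereal ((norm (z0 - u))\<^sup>2 / 2)
        + ereal lam * (penalized_obj f h A S chat u - ereal \<phi>min)"
    proof (cases "u \<in> Z")
      case True
      then show ?thesis
        using assms[OF True] u by (simp add: penalized_obj_finite gap_def norm_minus_commute)
    next
      case False
      then show ?thesis
        using closed_convex_on_infinite[OF h False] lam by (simp add: penalized_obj_def)
    qed
  qed
  then show ?thesis unfolding R by simp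
qed

lemma R_nonneg: "0 \<le> R"
proof (rule le_R)
  fix u assume "u \<in> Z"
  then show "0 \<le> gap u" using \<phi>c_lower[of u chat] lam by (simp add: gap_def)
qed

lemma T_ge: "chat \<le> T"
  unfolding T T_bound_def using R_nonneg lam \<sigma> by simp

lemma \<Theta>_pos: "0 < lam * \<Theta>"
  unfolding \<Theta> using lam M T_ge chat by (simp add: add_pos_nonneg)

text \<open>m < 1/lam enters twice: it gives \<open>m \<le> Mc c\<close>, as
  \<open>c * (onorm A)\<^sup>2\<close> exceeds 1/lam, and it lets the extra 1/lam in the refinement
  weight cover the Lipschitz constant \<open>max m M\<close> of \<open>grad f\<close>.\<close>

lemma inexact_proximal_point:
  assumes c: "penalty c" "c1 \<le> c"
  shows "inexact_proximal_point Z (penalized f A S c) h lam m (Mc c) \<sigma> \<rho> z0"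
proof
  have c0: "0 \<le> c" using c c1_pos chat by linarith
  have "c1 * (onorm A)\<^sup>2 \<le> c * (onorm A)\<^sup>2" using c by (intro mult_right_mono) auto
  then have ca: "M + 1 / lam \<le> c * (onorm A)\<^sup>2" using c1_pos(2) by linarith
  have m_lt: "m < 1 / lam" using lam by (simp add: field_simps)
  have fZ: "curvature_bounds_at m M Z f z" if "z \<in> Z" for z
    using f that by (simp add: curvature_class_def)
  show "closed_convex_on Z h" "z0 \<in> Z" "0 < m" "0 < lam" "lam * m < 1" "0 < \<sigma>" "\<sigma> < 1" "0 < \<rho>"
    by (fact h z0 m lam \<sigma> \<rho>)+
  show "m \<le> Mc c" using m_lt ca M by linarith
  show "penalized f A S c u \<le> linearization (penalized f A S c) z u + Mc c / 2 * (norm (u - z))\<^sup>2"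
    if "z \<in> Z" "u \<in> Z" for z u
    using curvature_bounds_at_penalized[OF S A(1) fZ[OF that(1)] c0] that(2)
    by (force simp: curvature_bounds_at_def)
  show "norm (grad (penalized f A S c) u - grad (penalized f A S c) z) \<le> (Mc c + 1 / lam) * norm (u - z)"
    if z: "z \<in> Z" "u \<in> Z" for z u
  proof -
    have "norm (grad f u - grad f z) \<le> max m M * norm (u - z)"
      using lipschitz_onD[OF lipschitz z(2,1)] by (simp add: dist_norm)
    then have "norm (grad (penalized f A S c) u - grad (penalized f A S c) z)
        \<le> (max m M + c * (onorm A)\<^sup>2) * norm (u - z)"
      using fZ z by (intro grad_penalized_lipschitz[OF S A(1) _ _ c0]) (auto simp: curvature_bounds_at_def)
    also have "\<dots> \<le> (Mc c + 1 / lam) * norm (u - z)"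
      using m_lt M m lam by (intro mult_right_mono) auto
    finally show ?thesis .
  qed
  fix z k assume z: "aipp_centre (penalized f A S c) h lam m (Mc c) \<sigma> \<rho> z0 z"
  show "curvature_bounds_at m (Mc c) Z (penalized f A S c)
      (acg_xt (1 - lam * m) (1 + lam * Mc c) (aipp_acg (penalized f A S c) h lam m (Mc c) z k))"
    using z c(1)
    by (intro curvature_bounds_at_penalized[OF S A(1) _ c0] curvature)
      (auto simp: linearization_points_def)
qed

text \<open>39 = 23 + 4 * 4: the logarithm of the inner curvature constant is at most four times
  \<open>log_plus1 (lam * \<Theta>)\<close>, which is itself at least 1.\<close>

definition rate :: real where
  "rate = 5600 * (R / ((1 - \<sigma>)\<^sup>2 * lam\<^sup>2 * \<rho>\<^sup>2)) + 39 * log_plus1 (lam * \<Theta>)"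

definition c_max :: real where
  "c_max = max c1 (2 * T)"

lemma c_max_le: "lam * c_max * (onorm A)\<^sup>2 \<le> 2 * (lam * \<Theta> + 1)"
proof -
  have "chat * (onorm A)\<^sup>2 \<le> T * (onorm A)\<^sup>2" using T_ge by (intro mult_right_mono) auto
  then have "lam * (c1 * (onorm A)\<^sup>2) \<le> lam * (\<Theta> + 1 / lam)"
    unfolding c1_pos(3) \<Theta> using lam by (intro mult_left_mono) auto
  then have 1: "lam * c1 * (onorm A)\<^sup>2 \<le> 2 * (lam * \<Theta> + 1)"
    using lam \<Theta>_pos by (simp add: distrib_left mult.assoc)
  have 2: "lam * (2 * T) * (onorm A)\<^sup>2 \<le> 2 * (lam * \<Theta> + 1)"
    using lam M by (simp add: \<Theta> algebra_simps)
  show ?thesis using 1 2 unfolding c_max_def by (simp add: max_def)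
qed

lemma inner_run:
  assumes c: "penalty c" "c1 \<le> c" "c \<le> c_max"
  shows "\<exists>z v n. aipp_run (penalized f A S c) h lam m (Mc c) \<sigma> \<rho> z0 (z, v) n \<and> z \<in> Z \<and>
    norm v \<le> \<rho> \<and> v - grad (penalized f A S c) z \<in> subdifferential h z \<and>
    (T \<le> c \<longrightarrow> norm (infeasibility A S z) \<le> \<eta>) \<and>
    real n \<le> sqrt (2 * lam * (onorm A)\<^sup>2 / min \<sigma> (1 - lam * m)) * rate * sqrt c"
proof -
  interpret P: inexact_proximal_point Z "penalized f A S c" h lam m "Mc c" \<sigma> \<rho> z0
    by (rule inexact_proximal_point[OF c(1,2)])
  have \<phi>: "P.\<phi> = \<phi>c c" by (simp add: fun_eq_iff P.\<phi>_def \<phi>c_def)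
  have c_chat: "chat < c" using c c1_pos by linarith
  have "\<phi>min \<le> P.\<phi> u" if "u \<in> Z" for u
  proof -
    have "0 \<le> (c - chat) / 2 * (infdist (A u) S)\<^sup>2" using c_chat by simp
    then show ?thesis using \<phi>c_lower[OF that, of c] unfolding \<phi> by linarith
  qed
  from P.terminates[OF this] obtain z v n where
    run: "aipp_run (penalized f A S c) h lam m (Mc c) \<sigma> \<rho> z0 (z, v) n" and
    z: "z \<in> Z" "norm v \<le> \<rho>" "v - grad (penalized f A S c) z \<in> subdifferential h z" and
    obj: "\<And>u. u \<in> Z \<Longrightarrow> lam * \<phi>c c z \<le> lam * \<phi>c c u + (norm (u - z0))\<^sup>2 / (2 * (1 - \<sigma>))" and
    n: "\<And>u. u \<in> Z \<Longrightarrow> real n \<le> sqrt (P.L / min \<sigma> P.\<mu>) * (5600 *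
      ((norm (u - z0))\<^sup>2 / 2 + lam * (\<phi>c c u - \<phi>min)) / ((1 - \<sigma>)\<^sup>2 * lam\<^sup>2 * \<rho>\<^sup>2) + 23 + 4 * ln P.L)"
    unfolding \<phi> by blast
  have feasible: "\<phi>c c u = \<phi>c chat u" if "A u \<in> S" for u
    using that by (simp add: \<phi>c_split[of c])
  have "norm (infeasibility A S z) \<le> \<eta>" if "T \<le> c"
  proof (rule ccontr)
    let ?d = "infdist (A z) S"
    assume "\<not> norm (infeasibility A S z) \<le> \<eta>"
    then have d: "\<eta> < ?d"
      by (simp add: infeasibility_def infdist_closest_point[OF S] norm_minus_commute)
    \<comment> \<open>Feasible points carry no penalty, so this upper bound does not grow with
      \<open>c\<close>, while the lower bound on the same quantity does. \<open>T\<close> is the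
      value of \<open>c\<close> at which the two meet at distance \<open>\<eta>\<close>.\<close>
    have "(1 - \<sigma>) * (lam * (\<phi>c c z - \<phi>min)) \<le> R"
    proof (rule le_R)
      fix u assume u: "u \<in> Z" "A u \<in> S"
      have "lam * (\<phi>c c z - \<phi>min) \<le> lam * (\<phi>c chat u - \<phi>min) + (norm (u - z0))\<^sup>2 / (2 * (1 - \<sigma>))"
        using obj[OF u(1)] unfolding feasible[OF u(2)] by (simp add: right_diff_distrib)
      then have "(1 - \<sigma>) * (lam * (\<phi>c c z - \<phi>min)) \<le> (1 - \<sigma>) *
          (lam * (\<phi>c chat u - \<phi>min) + (norm (u - z0))\<^sup>2 / (2 * (1 - \<sigma>)))"
        using \<sigma> by (intro mult_left_mono) auto
      also have "\<dots> = (1 - \<sigma>) * (lam * (\<phi>c chat u - \<phi>min)) + (norm (u - z0))\<^sup>2 / 2"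
        using \<sigma> by (simp add: field_simps)
      also have "(1 - \<sigma>) * (lam * (\<phi>c chat u - \<phi>min)) \<le> 1 * (lam * (\<phi>c chat u - \<phi>min))"
        using \<phi>c_lower[OF u(1), of chat] \<sigma> lam by (intro mult_right_mono) auto
      finally show "(1 - \<sigma>) * (lam * (\<phi>c c z - \<phi>min)) \<le> gap u" by (simp add: gap_def)
    qed
    moreover have "(1 - \<sigma>) * (lam * ((c - chat) / 2 * ?d\<^sup>2)) \<le> (1 - \<sigma>) * (lam * (\<phi>c c z - \<phi>min))"
      using \<phi>c_lower[OF z(1), of c] \<sigma> lam by (intro mult_left_mono) auto
    moreover have "(1 - \<sigma>) * (lam * ((c - chat) / 2 * \<eta>\<^sup>2)) < (1 - \<sigma>) * (lam * ((c - chat) / 2 * ?d\<^sup>2))"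
      using power_strict_mono[OF d, of 2] \<sigma> lam c_chat \<eta> by (intro mult_strict_left_mono) auto
    moreover have "R \<le> (1 - \<sigma>) * (lam * ((c - chat) / 2 * \<eta>\<^sup>2))"
    proof -
      have "2 * R / (lam * (1 - \<sigma>)) / \<eta>\<^sup>2 \<le> c - chat" using that unfolding T T_bound_def by linarith
      then show ?thesis using \<eta> lam \<sigma> by (simp add: field_simps)
    qed
    ultimately show False by linarith
  qed
  moreover have "real n \<le> sqrt (2 * lam * (onorm A)\<^sup>2 / min \<sigma> P.\<mu>) * rate * sqrt c"
  proof -
    define s where "s = sqrt (P.L / min \<sigma> P.\<mu>)"
    define D where "D = (1 - \<sigma>)\<^sup>2 * lam\<^sup>2 * \<rho>\<^sup>2"
    define K where "K = 23 + 4 * ln P.L"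
    have mn: "0 < min \<sigma> P.\<mu>" using \<sigma> P.\<mu> by simp
    have D: "0 < D" using \<sigma> lam \<rho> by (simp add: D_def)
    have s: "0 < s" using mn P.L by (simp add: s_def)
    \<comment> \<open>The count is solved for the gap so that \<open>le_R\<close> applies.\<close>
    have "(real n / s - K) * D / 5600 \<le> R"
    proof (rule le_R)
      fix u assume u: "u \<in> Z" "A u \<in> S"
      have "real n \<le> s * (5600 * gap u / D + K)"
        using n[OF u(1)] unfolding feasible[OF u(2)] gap_def s_def D_def K_def by (simp add: add.assoc)
      then have "real n / s - K \<le> 5600 * gap u / D" using s by (simp add: field_simps)
      then show "(real n / s - K) * D / 5600 \<le> gap u" using D by (simp add: field_simps)
    qed
    then have 1: "real n \<le> s * (5600 * (R / D) + K)" using s D by (simp add: field_simps)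
    have "c1 * (onorm A)\<^sup>2 \<le> c * (onorm A)\<^sup>2" using c by (intro mult_right_mono) auto
    then have "lam * (M + 1 / lam) \<le> lam * (c * (onorm A)\<^sup>2)"
      using c1_pos(2) lam by (intro mult_left_mono) auto
    \<comment> \<open>The starting penalty makes \<open>1 + lam * M\<close> at most
      \<open>lam * c * (onorm A)\<^sup>2\<close>; hence the factor 2 and the proportionality to
      \<open>c\<close>.\<close>
    then have L: "P.L \<le> 2 * lam * (onorm A)\<^sup>2 * c"
      using lam by (simp add: distrib_left mult_ac)
    have max_le: "4 * (t + 1) \<le> 8 * max 1 t" for t :: real by (simp add: max_def)
    have "lam * c * (onorm A)\<^sup>2 \<le> lam * c_max * (onorm A)\<^sup>2"
      using c lam by (intro mult_right_mono mult_left_mono) auto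
    then have "P.L \<le> 4 * (lam * \<Theta> + 1)" using L c_max_le by (simp add: mult_ac)
    also have "\<dots> \<le> 8 * max 1 (lam * \<Theta>)" by (rule max_le)
    finally have "ln P.L \<le> ln (8 * max 1 (lam * \<Theta>))" using P.L by (subst ln_le_cancel_iff) auto
    also have "\<dots> = 3 * ln 2 + ln (max 1 (lam * \<Theta>))"
      using ln_realpow[of "2::real" 3] by (simp add: ln_mult)
    also have "\<dots> \<le> 3 + log_plus1 (lam * \<Theta>)"
      using ln_2_less_1 \<Theta>_pos by (auto simp: log_plus1_def max_def)
    also have "\<dots> \<le> 4 * log_plus1 (lam * \<Theta>)" by (simp add: log_plus1_def)
    finally have "K \<le> 39 * log_plus1 (lam * \<Theta>)"
      by (auto simp: K_def log_plus1_def)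
    then have "5600 * (R / D) + K \<le> rate" by (simp add: rate_def D_def)
    moreover have "0 \<le> 5600 * (R / D) + K" using R_nonneg D P.L by (simp add: K_def)
    moreover have "s \<le> sqrt (2 * lam * (onorm A)\<^sup>2 / min \<sigma> P.\<mu>) * sqrt c"
      unfolding s_def real_sqrt_mult[symmetric] real_sqrt_le_iff times_divide_eq_left
      using L mn by (intro divide_right_mono) auto
    ultimately have "s * (5600 * (R / D) + K) \<le> (sqrt (2 * lam * (onorm A)\<^sup>2 / min \<sigma> P.\<mu>) * sqrt c) * rate"
      using s by (intro mult_mono) auto
    with 1 show ?thesis by (simp add: mult_ac)
  qed
  ultimately show ?thesis using run z by blast
qed

lemma rate_nonneg: "0 \<le> rate"
  using R_nonneg by (simp add: rate_def log_plus1_def)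

text \<open>The penalty doubles, so the costs, proportional to \<open>sqrt c\<close>, form a geometric
  series; the bound \<open>4 * sqrt c_max - 3 * sqrt c\<close> works since \<open>1 + 3 \<le> 3 * sqrt 2\<close>.\<close>

lemma outer_run:
  "penalty c \<Longrightarrow> c1 \<le> c \<Longrightarrow> c \<le> c_max \<Longrightarrow> T \<le> c * 2 ^ j \<Longrightarrow>
    \<exists>z p v q n. aipqp_run f h A S lam m M \<sigma> \<rho> \<eta> z0 c ((z, p), (v, q)) n \<and> z \<in> Z \<and>
      v \<in> (\<lambda>w. grad f z + w + adjoint A p) ` subdifferential h z \<and> norm v \<le> \<rho> \<and>
      A z + q \<in> S \<and> norm q \<le> \<eta> \<and>
      real n \<le> sqrt (2 * lam * (onorm A)\<^sup>2 / min \<sigma> (1 - lam * m)) * rate * (4 * sqrt c_max - 3 * sqrt c)"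
proof (induction j arbitrary: c)
  have finish: "\<exists>p v q. aipqp_run f h A S lam m M \<sigma> \<rho> \<eta> z0 c ((z, p), (v, q)) n \<and> z \<in> Z \<and>
      v \<in> (\<lambda>w. grad f z + w + adjoint A p) ` subdifferential h z \<and> norm v \<le> \<rho> \<and>
      A z + q \<in> S \<and> norm q \<le> \<eta> \<and>
      real n \<le> sqrt (2 * lam * (onorm A)\<^sup>2 / min \<sigma> (1 - lam * m)) * rate * (4 * sqrt c_max - 3 * sqrt c)"
    if run: "aipp_run (penalized f A S c) h lam m (Mc c) \<sigma> \<rho> z0 (z, v) n" and z: "z \<in> Z"
      and v: "norm v \<le> \<rho>" "v - grad (penalized f A S c) z \<in> subdifferential h z"
      and n: "real n \<le> sqrt (2 * lam * (onorm A)\<^sup>2 / min \<sigma> (1 - lam * m)) * rate * sqrt c"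
      and q: "norm (infeasibility A S z) \<le> \<eta>" and c: "c \<le> c_max" for c z v n
  proof -
    have "f differentiable (at z)"
      using f z by (auto simp: curvature_class_def curvature_bounds_at_def)
    then have "grad (penalized f A S c) z = grad f z + adjoint A (multiplier A S c z)"
      using grad_eq[OF GDERIV_penalized[OF S A(1)]] linear_cmul[OF adjoint_linear[OF A(1)]]
      by (simp add: multiplier_def)
    then have "v = grad f z + (v - grad (penalized f A S c) z) + adjoint A (multiplier A S c z)" by simp
    then have "v \<in> (\<lambda>w. grad f z + w + adjoint A (multiplier A S c z)) ` subdifferential h z"
      using v(2) by (rule image_eqI)
    moreover have "A z + infeasibility A S z \<in> S"
      using closest_point_in_set[OF S(1,3)] by (simp add: infeasibility_def)
    moreover have "sqrt (2 * lam * (onorm A)\<^sup>2 / min \<sigma> (1 - lam * m)) * rate * sqrt c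
        \<le> sqrt (2 * lam * (onorm A)\<^sup>2 / min \<sigma> (1 - lam * m)) * rate * (4 * sqrt c_max - 3 * sqrt c)"
      using c rate_nonneg lam \<sigma> by (intro mult_left_mono) auto
    ultimately show ?thesis using aipqp_finish[OF run q] z v(1) n q by (meson order_trans)
  qed
  {
    case (0 c)
    then show ?case using inner_run[OF 0(1-3)] finish[OF _ _ _ _ _ _ 0(3)] by (metis mult.right_neutral power_0)
  next
    case (Suc j c)
    from inner_run[OF Suc.prems(1-3)] obtain z v n where
      run: "aipp_run (penalized f A S c) h lam m (Mc c) \<sigma> \<rho> z0 (z, v) n" and
      z: "z \<in> Z" "norm v \<le> \<rho>" "v - grad (penalized f A S c) z \<in> subdifferential h z" and
      q: "T \<le> c \<longrightarrow> norm (infeasibility A S z) \<le> \<eta>" and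
      n: "real n \<le> sqrt (2 * lam * (onorm A)\<^sup>2 / min \<sigma> (1 - lam * m)) * rate * sqrt c" by blast
    show ?case
    proof (cases "norm (infeasibility A S z) \<le> \<eta>")
      case True
      then show ?thesis using finish[OF run z n True Suc.prems(3)] by blast
    next
      case False
      have c0: "0 < c" using Suc.prems(2) c1_pos chat by linarith
      have p: "penalty (2 * c)" using Suc.prems(1) run False by (rule aipqp_penalty.intros(2))
      \<comment> \<open>A failed infeasibility test excludes \<open>T \<le> c\<close>, so the
        doubled parameter stays below 2 T.\<close>
      have c2: "c1 \<le> 2 * c" "2 * c \<le> c_max" "T \<le> 2 * c * 2 ^ j"
        using c0 Suc.prems(2,4) False q by (auto simp: c_max_def mult_ac)
      define W where "W = sqrt (2 * lam * (onorm A)\<^sup>2 / min \<sigma> (1 - lam * m)) * rate"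
      have W: "0 \<le> W" using rate_nonneg lam \<sigma> by (simp add: W_def)
      from Suc.IH[OF p c2] obtain z' p' v' q' n' where
        run': "aipqp_run f h A S lam m M \<sigma> \<rho> \<eta> z0 (2 * c) ((z', p'), (v', q')) n'" and
        z': "z' \<in> Z" "v' \<in> (\<lambda>w. grad f z' + w + adjoint A p') ` subdifferential h z'"
          "norm v' \<le> \<rho>" "A z' + q' \<in> S" "norm q' \<le> \<eta>" and
        n': "real n' \<le> W * (4 * sqrt c_max - 3 * sqrt (2 * c))" unfolding W_def by blast
      have "4 / 3 \<le> sqrt (2 :: real)" by (rule real_le_rsqrt) (simp add: power_divide)
      then have "4 / 3 * sqrt c \<le> sqrt (2 * c)"
        unfolding real_sqrt_mult using c0 by (intro mult_right_mono) auto
      then have "W * sqrt c + W * (4 * sqrt c_max - 3 * sqrt (2 * c)) \<le> W * (4 * sqrt c_max - 3 * sqrt c)"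
        unfolding distrib_left[symmetric] using W by (intro mult_left_mono) auto
      then have "real (n + n') \<le> W * (4 * sqrt c_max - 3 * sqrt c)"
        using n n' unfolding W_def[symmetric] by simp
      then show ?thesis
        using aipqp_continue[OF run False run'] z' unfolding W_def by blast
    qed
  }
qed

end

section \<open>Total iteration count\<close>

theorem theorem4p1p6:
  fixes Z :: "'a::euclidean_space set" and h :: "'a \<Rightarrow> ereal" and f :: "'a \<Rightarrow> real"
    and A :: "'a \<Rightarrow> 'b::euclidean_space" and S :: "'b set" and F :: "'a set"
    and m M chat \<rho> \<eta> \<sigma> lam R T \<Theta> :: real and z0 :: 'a
  assumes "Z \<noteq> {}" and "convex Z" and "closed_convex_on Z h"
    and "m > 0" and "M > 0" and "curvature_class m M Z f"
    and "linear A" and "A \<noteq> (\<lambda>_. 0)"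
    and "closed S" and "convex S"
    and "F = {z. A z \<in> S}" and "F \<noteq> {}"
    and "chat > 0" and "(INF z. penalized_obj f h A S chat z) > -\<infinity>"
    and "\<rho> > 0" and "\<eta> > 0" and "0 < \<sigma>" and "\<sigma> < 1" and "0 < lam" and "lam < 1 / m"
    and "z0 \<in> Z"
    and "(max m M)-lipschitz_on Z (grad f)"
    and "\<forall>x \<in> linearization_points f h A S lam m M \<sigma> \<rho> \<eta> z0 (aipqp_c1 A chat M lam).
           curvature_bounds_at m M Z f x"
    and "prox_gap F lam (penalized_obj f h A S chat) z0 = ereal R"
    and "T = T_bound chat R \<eta> lam \<sigma>" and "\<Theta> = M + T * (onorm A)\<^sup>2"
  shows "\<exists>zhat phat vhat qhat N.
           aipqp_run f h A S lam m M \<sigma> \<rho> \<eta> z0 (aipqp_c1 A chat M lam)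
             ((zhat, phat), (vhat, qhat)) N \<and>
           zhat \<in> Z \<and>
           vhat \<in> (\<lambda>w. grad f zhat + w + adjoint A phat) ` subdifferential h zhat \<and>
           norm vhat \<le> \<rho> \<and>
           A zhat + qhat \<in> S \<and>
           norm qhat \<le> \<eta> \<and>
           real N \<le> universal_const * max 1 (iteration_bound \<Theta> R lam m \<sigma> \<rho>)"
proof -
  have "lam * m < 1" using assms by (simp add: field_simps)
  then interpret P: quadratic_penalty Z h f A S m M chat \<rho> \<eta> \<sigma> lam R T \<Theta> z0
    using assms by (intro quadratic_penalty.intro) auto
  let ?W = "sqrt (2 * lam * (onorm A)\<^sup>2 / min \<sigma> (1 - lam * m))"
  have mn: "0 < min \<sigma> (1 - lam * m)" using \<open>0 < \<sigma>\<close> \<open>lam * m < 1\<close> by simp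
  have c1: "0 < P.c1" using P.c1_pos(1) \<open>chat > 0\<close> by linarith
  obtain j where "T / P.c1 < 2 ^ j" using real_arch_pow[of 2] by auto
  then have "T \<le> P.c1 * 2 ^ j" using c1 by (simp add: field_simps)
  moreover have "P.c1 \<le> P.c_max" by (simp add: P.c_max_def)
  ultimately obtain z p v q n where
    out: "aipqp_run f h A S lam m M \<sigma> \<rho> \<eta> z0 P.c1 ((z, p), (v, q)) n" "z \<in> Z"
      "v \<in> (\<lambda>w. grad f z + w + adjoint A p) ` subdifferential h z" "norm v \<le> \<rho>"
      "A z + q \<in> S" "norm q \<le> \<eta>" and
    n: "real n \<le> ?W * P.rate * (4 * sqrt P.c_max - 3 * sqrt P.c1)"
    using P.outer_run[OF aipqp_penalty.intros(1)] by blast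
  have W: "0 \<le> ?W" using mn \<open>0 < lam\<close> by simp
  have W_le: "?W * sqrt P.c_max \<le> 2 * sqrt ((lam * \<Theta> + 1) / min \<sigma> (1 - lam * m))"
  proof -
    have "2 * lam * (onorm A)\<^sup>2 * P.c_max / min \<sigma> (1 - lam * m)
        \<le> 4 * (lam * \<Theta> + 1) / min \<sigma> (1 - lam * m)"
      using P.c_max_le mn by (intro divide_right_mono) (auto simp: mult_ac)
    then have "sqrt (2 * lam * (onorm A)\<^sup>2 / min \<sigma> (1 - lam * m) * P.c_max)
        \<le> sqrt (2\<^sup>2 * ((lam * \<Theta> + 1) / min \<sigma> (1 - lam * m)))"
      by simp
    then show ?thesis unfolding real_sqrt_mult by simp
  qed
  have "real n \<le> ?W * P.rate * (4 * sqrt P.c_max)"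
    using n mult_left_mono[of "4 * sqrt P.c_max - 3 * sqrt P.c1" "4 * sqrt P.c_max" "?W * P.rate"]
      W P.rate_nonneg c1 by simp
  also have "\<dots> = 4 * (?W * sqrt P.c_max) * P.rate" by simp
  also have "\<dots> \<le> 4 * (2 * sqrt ((lam * \<Theta> + 1) / min \<sigma> (1 - lam * m))) * P.rate"
    using W_le P.rate_nonneg by (intro mult_right_mono mult_left_mono) auto
  \<comment> \<open>44800 = 8 * 5600; the coefficient 39 of the logarithm is rounded up to
    5600.\<close>
  also have "\<dots> \<le> 44800 * iteration_bound \<Theta> R lam m \<sigma> \<rho>"
  proof -
    have "0 \<le> log_plus1 (lam * \<Theta>)" by (simp add: log_plus1_def)
    then have "P.rate \<le> 5600 * (R / ((1 - \<sigma>)\<^sup>2 * lam\<^sup>2 * \<rho>\<^sup>2) + log_plus1 (lam * \<Theta>))"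
      by (simp add: P.rate_def)
    from mult_left_mono[OF this, of "8 * sqrt ((lam * \<Theta> + 1) / min \<sigma> (1 - lam * m))"]
    show ?thesis using P.\<Theta>_pos mn by (simp add: iteration_bound_def)
  qed
  also have "\<dots> \<le> universal_const * max 1 (iteration_bound \<Theta> R lam m \<sigma> \<rho>)"
    by (simp add: universal_const_def max_def)
  finally show ?thesis using out by blast
qed

end
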